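(* Let $G$ be the following Sylow $p$-subgroup of $O(2m+1,q)$. If $q$ is odd, $G=\{N\in U(2m+1,\mathbb{F}_q):N^TYN=Y\}$ with $Y=\begin{pmatrix}0&0&J_m\\ 0&2&0\\ J_m&0&0\end{pmatrix}$. If $q$ is even, $G$ is the group of all $N=\begin{pmatrix}A&0&0\\ B&1&0\\ C&D&E\end{pmatrix}\in U(2m+1,\mathbb{F}_q)$, with $A,E\in U(m,\mathbb{F}_q)$, such that $N^TY_0N=Y_0$ for $Y_0=\begin{pmatrix}0&0&J_m\\ 0&0&0\\ J_m&0&0\end{pmatrix}$ and $S=A^TJ_mC$ satisfies $s_{ii}=b_{1i}^2$ for $i=1,\dots,m$. Let $h_1=\sum_{i=1}^mx_{2m+2-i}x_i+x_{m+1}^2$ and, for $k\ge2$, $h_k=\sum_{i=1}^m\left(x_{2m+2-i}^{q^{k-1}}x_i+x_{2m+2-i}x_i^{q^{k-1}}\right)+2x_{m+1}^{q^{k-1}+1}$. Then the invariant field $\mathbb{F}_q(V)^G$ is generated by the polynomials $N(x_i)$, $i=1,\dots,m+1$, and $h_k$, $k=1,\dots,m$; i.e. $$\mathbb{F}_q(V)^G=\mathbb{F}_q(x_1,N(x_2),\dots,N(x_{m+1}),h_1,\dots,h_m).$$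
   Context: $q$ is a power of a prime $p$, $m\ge 1$, $V=\mathbb{F}_q^{2m+1}$ (column vectors) with $x_1,\dots,x_{2m+1}$ the dual basis of the standard basis; $\mathbb{F}_q[V]=\mathbb{F}_q[x_1,\dots,x_{2m+1}]$, $\mathbb{F}_q(V)$ is its fraction field, and $G$ acts by $(g\cdot f)(v)=f(g^{-1}v)$. $N(x_i)=\prod_{y\in G\cdot x_i}y$ is the product over the $G$-orbit of $x_i$ (so $N(x_1)=x_1$). $U(n,\mathbb{F})$ is the group of lower triangular $n\times n$ matrices over $\mathbb{F}$ with ones on the diagonal; $J_m$ is the $m\times m$ matrix with ones on the antidiagonal and zeros elsewhere; $b_{1i}$ and $s_{ij}$ are the entries of the $1\times m$ matrix $B$ and of $S$. $O(2m+1,q)$ is the group of invertible matrices preserving the quadratic form $h_1$ on $V$. *)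

theory Defs
  imports
    "HOL-Library.Poly_Mapping"
    "HOL-Library.Cardinality"
    "HOL-Computational_Algebra.Fraction_Field"
    "HOL-Algebra.Generated_Fields"
    "HOL-Algebra.Algebraic_Closure_Type"
    "Jordan_Normal_Form.Matrix"
    "Jordan_Normal_Form.Gauss_Jordan_Elimination"
begin

section \<open>Polynomials and rational functions\<close>

text \<open>
  Polynomials in the variables \<open>x\<^sub>0, x\<^sub>1, x\<^sub>2, \<dots>\<close>, as finitely supported functions from exponent
  vectors to coefficients. The ring \<open>F[x\<^sub>1,\<dots>,x\<^sub>n]\<close> is the subset \<open>polys n\<close>, and its fraction field
  is the subset \<open>ratfuns n\<close> of the fraction field of the big ring.
\<close>

type_synonym 'a mpol = "(nat \<Rightarrow>\<^sub>0 nat) \<Rightarrow>\<^sub>0 'a"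

definition Var :: "nat \<Rightarrow> 'a::field mpol" where
  "Var i = Poly_Mapping.single (Poly_Mapping.single i 1) 1"

definition Const :: "'a::field \<Rightarrow> 'a mpol" where
  "Const c = Poly_Mapping.single 0 c"

definition polys :: "nat \<Rightarrow> 'a::field mpol set" where
  "polys n = {f. \<forall>t \<in> Poly_Mapping.keys f. Poly_Mapping.keys t \<subseteq> {1..n}}"

definition ratfuns :: "nat \<Rightarrow> 'a::field mpol fract set" where
  "ratfuns n = {Fract a b | a b. a \<in> polys n \<and> b \<in> polys n \<and> b \<noteq> 0}"

definition of_pol :: "'a::field mpol \<Rightarrow> 'a mpol fract" where
  "of_pol f = Fract f 1"

text \<open>The subfield \<open>F(S)\<close> of the field of rational functions generated by the constants and \<open>S\<close>.\<close>

definition field_adjoin :: "'a::field mpol set \<Rightarrow> 'a mpol fract set" where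
  "field_adjoin S = generate_field ring_of_type_algebra (of_pol ` (range Const \<union> S))"

definition monom_subst :: "(nat \<Rightarrow> 'a::field mpol) \<Rightarrow> (nat \<Rightarrow>\<^sub>0 nat) \<Rightarrow> 'a mpol" where
  "monom_subst \<sigma> t = (\<Prod>i \<in> Poly_Mapping.keys t. \<sigma> i ^ Poly_Mapping.lookup t i)"

definition poly_subst :: "(nat \<Rightarrow> 'a::field mpol) \<Rightarrow> 'a mpol \<Rightarrow> 'a mpol" where
  "poly_subst \<sigma> f =
     (\<Sum>t \<in> Poly_Mapping.keys f. Const (Poly_Mapping.lookup f t) * monom_subst \<sigma> t)"


section \<open>The action of invertible matrices\<close>

text \<open>
  The action \<open>(g \<cdot> f)(v) = f(g\<^sup>-\<^sup>1 v)\<close> on column vectors: \<open>g \<cdot> x\<^sub>i\<close> is the linear form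
  \<open>v \<mapsto> (g\<^sup>-\<^sup>1 v)\<^sub>i\<close>, i.e. the sum of the \<open>(g\<^sup>-\<^sup>1)\<^sub>i\<^sub>j x\<^sub>j\<close>, and \<open>g\<close> acts on polynomials by substitution.
  Matrix indices start at \<open>0\<close>, variable indices at \<open>1\<close>. Variables
  outside \<open>x\<^sub>1,\<dots>,x\<^sub>n\<close> are fixed.
\<close>

definition act_var :: "'a::field mat \<Rightarrow> nat \<Rightarrow> 'a mpol" where
  "act_var g i =
     (if i \<in> {1..dim_row g}
      then \<Sum>j = 1..dim_row g. Const (the (mat_inverse g) $$ (i - 1, j - 1)) * Var j
      else Var i)"

definition act :: "'a::field mat \<Rightarrow> 'a mpol \<Rightarrow> 'a mpol" where
  "act g = poly_subst (act_var g)"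

text \<open>
  The induced action on fractions, \<open>g \<cdot> (a/b) = (g \<cdot> a)/(g \<cdot> b)\<close>. For invertible \<open>g\<close> this does
  not depend on the representation; see \<open>act_frac_Fract\<close> below.
\<close>

definition act_frac :: "'a::field mat \<Rightarrow> 'a mpol fract \<Rightarrow> 'a mpol fract" where
  "act_frac g r = (THE s. \<exists>a b. b \<noteq> 0 \<and> r = Fract a b \<and> s = Fract (act g a) (act g b))"

definition invariant_field :: "nat \<Rightarrow> 'a::field mat set \<Rightarrow> 'a mpol fract set" where
  "invariant_field n G = {r \<in> ratfuns n. \<forall>g \<in> G. act_frac g r = r}"

definition orbit_norm :: "'a::field mat set \<Rightarrow> nat \<Rightarrow> 'a mpol" where
  "orbit_norm G i = (\<Prod>y \<in> (\<lambda>g. act g (Var i)) ` G. y)"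


section \<open>The matrix groups\<close>

definition unitri :: "nat \<Rightarrow> 'a::field mat set" where
  "unitri n = {N \<in> carrier_mat n n.
     (\<forall>i<n. N $$ (i, i) = 1) \<and> (\<forall>i<n. \<forall>j<n. i < j \<longrightarrow> N $$ (i, j) = 0)}"

definition antidiag :: "nat \<Rightarrow> 'a::field mat" where
  "antidiag m = mat m m (\<lambda>(i, j). if i + j + 1 = m then 1 else 0)"

definition append_cols :: "'a::field mat \<Rightarrow> 'a mat \<Rightarrow> 'a mat" where
  "append_cols A B = four_block_mat A B (0\<^sub>m 0 (dim_col A)) (0\<^sub>m 0 (dim_col B))"

definition three_block_mat ::
    "'a::field mat \<Rightarrow> 'a mat \<Rightarrow> 'a mat \<Rightarrow> 'a mat \<Rightarrow> 'a mat \<Rightarrow> 'a mat \<Rightarrow> 'a mat \<Rightarrow> 'a mat \<Rightarrow> 'a mat \<Rightarrow> 'a mat"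
  where
  "three_block_mat A11 A12 A13
                   A21 A22 A23
                   A31 A32 A33 =
     append_cols A11 (append_cols A12 A13) @\<^sub>r
     append_cols A21 (append_cols A22 A23) @\<^sub>r
     append_cols A31 (append_cols A32 A33)"

definition Y_mat :: "nat \<Rightarrow> 'a::field \<Rightarrow> 'a mat" where
  "Y_mat m c = three_block_mat
     (0\<^sub>m m m)    (0\<^sub>m m 1)          (antidiag m)
     (0\<^sub>m 1 m)    (c \<cdot>\<^sub>m 1\<^sub>m 1)       (0\<^sub>m 1 m)
     (antidiag m) (0\<^sub>m m 1)          (0\<^sub>m m m)"

text \<open>
  \<open>Y_mat m 2\<close> is \<open>Y\<close> and \<open>Y_mat m 0\<close> is \<open>Y\<^sub>0\<close>. The field \<open>F\<^sub>q\<close> is the type \<open>'a\<close>, with \<open>q = CARD('a)\<close>;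
  the order of a finite field is automatically a power of a prime.
\<close>

definition G_odd :: "nat \<Rightarrow> 'a::field mat set" where
  "G_odd m = {N \<in> unitri (2 * m + 1). transpose_mat N * Y_mat m 2 * N = Y_mat m 2}"

definition G_even :: "nat \<Rightarrow> 'a::field mat set" where
  "G_even m = {N \<in> unitri (2 * m + 1).
     \<exists>A B C D E.
       A \<in> unitri m \<and> B \<in> carrier_mat 1 m \<and> C \<in> carrier_mat m m \<and>
       D \<in> carrier_mat m 1 \<and> E \<in> unitri m \<and>
       N = three_block_mat
             A (0\<^sub>m m 1) (0\<^sub>m m m)
             B (1\<^sub>m 1)   (0\<^sub>m 1 m)
             C D         E \<and>
       transpose_mat N * Y_mat m 0 * N = Y_mat m 0 \<and>
       (\<forall>i<m. (transpose_mat A * antidiag m * C) $$ (i, i) = (B $$ (0, i))\<^sup>2)}"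

definition sylow_G :: "nat \<Rightarrow> 'a::{field, finite} mat set" where
  "sylow_G m = (if odd (CARD('a)) then G_odd m else G_even m)"

definition h :: "nat \<Rightarrow> nat \<Rightarrow> 'a::{field, finite} mpol" where
  "h m k =
     (if k = 1 then (\<Sum>i = 1..m. Var (2*m + 2 - i) * Var i) + Var (m + 1) ^ 2
      else (\<Sum>i = 1..m. Var (2*m + 2 - i) ^ (CARD('a) ^ (k - 1)) * Var i
                        + Var (2*m + 2 - i) * Var i ^ (CARD('a) ^ (k - 1)))
           + 2 * Var (m + 1) ^ (CARD('a) ^ (k - 1) + 1))"


section \<open>Well-definedness of the action on fractions\<close>

lemma Const_simps: "Const 0 = 0" "Const 1 = 1"
  "Const (a + b) = Const a + Const b" "Const (a * b) = Const a * Const b"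
  by (simp_all add: Const_def single_add mult_single)

lemma monom_subst_superset:
  assumes "finite A" "Poly_Mapping.keys t \<subseteq> A"
  shows "monom_subst \<sigma> t = (\<Prod>i\<in>A. \<sigma> i ^ Poly_Mapping.lookup t i)"
  unfolding monom_subst_def
  by (rule prod.mono_neutral_left) (use assms in \<open>auto simp: in_keys_iff\<close>)

lemma monom_subst_add: "monom_subst \<sigma> (s + t) = monom_subst \<sigma> s * monom_subst \<sigma> t"
proof -
  let ?A = "Poly_Mapping.keys s \<union> Poly_Mapping.keys t"
  have "Poly_Mapping.keys (s + t) \<subseteq> ?A" by (rule Poly_Mapping.keys_add)
  then show ?thesis
    by (simp add: monom_subst_superset[of ?A] lookup_add power_add prod.distrib)
qed

lemma poly_subst_superset:
  assumes "finite A" "Poly_Mapping.keys f \<subseteq> A"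
  shows "poly_subst \<sigma> f = (\<Sum>t\<in>A. Const (Poly_Mapping.lookup f t) * monom_subst \<sigma> t)"
  unfolding poly_subst_def
  by (rule sum.mono_neutral_left) (use assms in \<open>auto simp: in_keys_iff Const_simps\<close>)

lemma poly_subst_add: "poly_subst \<sigma> (f + g) = poly_subst \<sigma> f + poly_subst \<sigma> g"
proof -
  let ?A = "Poly_Mapping.keys f \<union> Poly_Mapping.keys g"
  have "Poly_Mapping.keys (f + g) \<subseteq> ?A" by (rule Poly_Mapping.keys_add)
  then show ?thesis
    by (simp add: poly_subst_superset[of ?A] lookup_add Const_simps algebra_simps sum.distrib)
qed

lemma poly_subst_zero [simp]: "poly_subst \<sigma> 0 = 0"
  by (simp add: poly_subst_def)

lemma poly_subst_single:
  "poly_subst \<sigma> (Poly_Mapping.single t c) = Const c * monom_subst \<sigma> t"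
  by (subst poly_subst_superset[of "{t}"]) (auto simp: lookup_single)

lemma poly_subst_sum: "poly_subst \<sigma> (sum F A) = (\<Sum>i\<in>A. poly_subst \<sigma> (F i))"
  by (induction A rule: infinite_finite_induct) (simp_all add: poly_subst_add)

lemma mpol_induct [case_names single add]:
  fixes f :: "'a::field mpol"
  assumes "\<And>t c. P (Poly_Mapping.single t c)" "\<And>f g. P f \<Longrightarrow> P g \<Longrightarrow> P (f + g)"
  shows "P f"
proof (induction f rule: Poly_Mapping.update_induct)
  case const
  show ?case using assms(1)[of 0 0] by simp
next
  case (update f a b)
  have "Poly_Mapping.update a b f = f + Poly_Mapping.single a b"
    using update by (intro poly_mapping_eqI)
      (auto simp: lookup_update lookup_add lookup_single in_keys_iff when_def)
  then show ?case using update assms by auto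
qed

lemma poly_subst_mult: "poly_subst \<sigma> (f * g) = poly_subst \<sigma> f * poly_subst \<sigma> g"
proof (induction f rule: mpol_induct)
  case (single s a)
  show ?case
  proof (induction g rule: mpol_induct)
    case (single t b)
    show ?case by (simp add: mult_single poly_subst_single monom_subst_add Const_simps)
  qed (simp add: algebra_simps poly_subst_add)
qed (simp add: algebra_simps poly_subst_add)

lemma poly_subst_Const [simp]: "poly_subst \<sigma> (Const c) = Const c"
  unfolding Const_def[of c] poly_subst_single by (simp add: monom_subst_def Const_def)

lemma poly_subst_one [simp]: "poly_subst \<sigma> 1 = 1"
  using poly_subst_Const[of \<sigma> 1] by (simp add: Const_simps)

lemma poly_subst_Var [simp]: "poly_subst \<sigma> (Var i) = \<sigma> i"
  by (simp add: Var_def poly_subst_single monom_subst_def Const_simps)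

lemma poly_subst_power: "poly_subst \<sigma> (f ^ k) = poly_subst \<sigma> f ^ k"
  by (induction k) (simp_all add: poly_subst_mult)

lemma poly_subst_prod: "poly_subst \<sigma> (prod F A) = (\<Prod>i\<in>A. poly_subst \<sigma> (F i))"
  by (induction A rule: infinite_finite_induct) (simp_all add: poly_subst_mult)

lemma poly_subst_poly_subst:
  "poly_subst \<tau> (poly_subst \<sigma> f) = poly_subst (\<lambda>i. poly_subst \<tau> (\<sigma> i)) f"
proof -
  have "poly_subst \<tau> (monom_subst \<sigma> t) = monom_subst (\<lambda>i. poly_subst \<tau> (\<sigma> i)) t" for t
    by (simp add: monom_subst_def poly_subst_prod poly_subst_power)
  then show ?thesis
    by (simp add: poly_subst_def[of \<sigma>] poly_subst_def[of "\<lambda>i. poly_subst \<tau> (\<sigma> i)"]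
        poly_subst_sum poly_subst_mult)
qed

lemma Var_power: "Var i ^ k = Poly_Mapping.single (Poly_Mapping.single i k) 1"
  by (induction k) (simp_all add: Var_def mult_single flip: single_add)

lemma monom_subst_Var: "monom_subst Var t = Poly_Mapping.single t 1"
proof -
  have "finite A \<Longrightarrow> (\<Prod>i\<in>A. Var i ^ Poly_Mapping.lookup t i)
        = Poly_Mapping.single (\<Sum>i\<in>A. Poly_Mapping.single i (Poly_Mapping.lookup t i)) (1::'a::field)"
    for A
    by (induction A rule: finite_induct) (simp_all add: Var_power mult_single)
  moreover have "(\<Sum>i\<in>Poly_Mapping.keys t. Poly_Mapping.single i (Poly_Mapping.lookup t i)) = t"
  proof (rule poly_mapping_eqI)
    fix k
    have "Poly_Mapping.lookup (\<Sum>i\<in>A. Poly_Mapping.single i (c i)) k = (\<Sum>i\<in>A. if i = k then c i else 0)"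
      for A and c :: "nat \<Rightarrow> nat"
      by (induction A rule: infinite_finite_induct) (auto simp: lookup_add lookup_single when_def)
    then show "Poly_Mapping.lookup (\<Sum>i\<in>Poly_Mapping.keys t.
        Poly_Mapping.single i (Poly_Mapping.lookup t i)) k = Poly_Mapping.lookup t k"
      by (simp add: in_keys_iff)
  qed
  ultimately show ?thesis by (simp add: monom_subst_def)
qed

lemma poly_subst_Var_id: "poly_subst Var f = f"
  by (induction f rule: mpol_induct)
    (simp_all add: poly_subst_add poly_subst_single monom_subst_Var Const_def mult_single)

lemma mat_inverse_invertible:
  fixes g :: "'a::field mat"
  assumes "g \<in> carrier_mat n n" "g' \<in> carrier_mat n n" "g * g' = 1\<^sub>m n" "g' * g = 1\<^sub>m n"
  shows "mat_inverse g = Some g'"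
proof (cases "mat_inverse g")
  case None
  have "g \<in> Units (ring_mat TYPE('a) n ())"
    using assms by (auto simp: Units_def ring_mat_def)
  with mat_inverse(1)[OF assms(1) None, of "()"] show ?thesis by simp
next
  case (Some k)
  then have k: "g * k = 1\<^sub>m n" "k \<in> carrier_mat n n"
    using mat_inverse(2)[OF assms(1)] by auto
  have "g' = g' * (g * k)" using k assms by simp
  also have "\<dots> = (g' * g) * k" using k assms by (metis assoc_mult_mat)
  finally show ?thesis using Some k assms by simp
qed

lemma act_act_inverse:
  assumes "g \<in> carrier_mat n n" "g' \<in> carrier_mat n n" "g * g' = 1\<^sub>m n" "g' * g = 1\<^sub>m n"
  shows "act g (act g' f) = f"
proof -
  have inv: "mat_inverse g = Some g'" "mat_inverse g' = Some g"
    using assms mat_inverse_invertible by blast+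
  have dims: "dim_row g = n" "dim_row g' = n" using assms by auto
  have "poly_subst (act_var g) (act_var g' i) = Var i" for i
  proof (cases "i \<in> {1..n}")
    case True
    have "poly_subst (act_var g) (act_var g' i)
          = (\<Sum>j = 1..n. Const (g $$ (i-1, j-1)) * (\<Sum>k = 1..n. Const (g' $$ (j-1, k-1)) * Var k))"
      using True by (simp add: act_var_def[of g' i] dims inv poly_subst_sum poly_subst_mult)
        (intro sum.cong, auto simp: act_var_def dims inv)
    also have "\<dots> = (\<Sum>k = 1..n. Const (\<Sum>j = 1..n. g $$ (i-1, j-1) * g' $$ (j-1, k-1)) * Var k)"
    proof -
      have C: "Const (sum F A) = (\<Sum>x\<in>A. Const (F x))" for F :: "nat \<Rightarrow> 'a" and A
        by (induction A rule: infinite_finite_induct) (simp_all add: Const_simps)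
      show ?thesis
        by (simp add: C sum_distrib_left sum_distrib_right Const_simps mult.assoc)
          (rule sum.swap)
    qed
    also have "\<dots> = (\<Sum>k = 1..n. if k = i then Var k else 0)"
    proof (rule sum.cong, goal_cases)
      case (2 k)
      have "(\<Sum>j = 1..n. g $$ (i-1, j-1) * g' $$ (j-1, k-1))
            = (\<Sum>j<n. g $$ (i-1, j) * g' $$ (j, k-1))"
        by (rule sum.reindex_bij_witness[of _ Suc "\<lambda>j. j - 1"]) auto
      also have "\<dots> = (g * g') $$ (i-1, k-1)"
        using 2 True assms(1,2) by (auto simp: scalar_prod_def atLeast0LessThan)
      also have "\<dots> = (if k = i then 1 else 0)"
        using 2 True unfolding assms(3) by auto
      finally show ?case by (auto simp: Const_simps)
    qed simp
    also have "\<dots> = Var i" using True by simp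
    finally show ?thesis .
  next
    case False
    then show ?thesis by (auto simp: act_var_def dims)
  qed
  then show ?thesis
    by (simp add: act_def poly_subst_poly_subst poly_subst_Var_id)
qed

lemma act_frac_Fract:
  assumes "g \<in> carrier_mat n n" "g' \<in> carrier_mat n n" "g * g' = 1\<^sub>m n" "g' * g = 1\<^sub>m n"
    and "b \<noteq> 0"
  shows "act_frac g (Fract a b) = Fract (act g a) (act g b)"
  unfolding act_frac_def
proof (rule the_equality)
  show "\<exists>a' b'. b' \<noteq> 0 \<and> Fract a b = Fract a' b' \<and>
          Fract (act g a) (act g b) = Fract (act g a') (act g b')"
    using assms by blast
  have nz: "act g c \<noteq> 0" if "c \<noteq> 0" for c
  proof
    assume "act g c = 0"
    then have "act g' (act g c) = 0" by (simp add: act_def)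
    then show False
      using act_act_inverse[of g' n g c] assms(1-4) that by simp
  qed
  fix s assume "\<exists>a' b'. b' \<noteq> 0 \<and> Fract a b = Fract a' b' \<and> s = Fract (act g a') (act g b')"
  then obtain a' b' where *: "b' \<noteq> 0" "Fract a b = Fract a' b'"
    "s = Fract (act g a') (act g b')" by blast
  then have "a * b' = a' * b" using assms(5) by (simp add: eq_fract)
  then have "act g a * act g b' = act g a' * act g b"
    unfolding act_def by (metis poly_subst_mult)
  then show "s = Fract (act g a) (act g b)"
    using * assms(5) nz by (simp add: eq_fract)
qed

end

theory Submission
  imports
    Defs
    "Jordan_Normal_Form.Determinant"
begin

text \<open>
  Both for odd and for even \<open>q\<close> the group \<open>G\<close> consists of the lower unitriangular isometries of the
  quadratic form \<open>h\<^sub>1\<close>, so the \<open>h\<^sub>k\<close>, the values of its polar form on \<open>x\<close> and its Frobenius twists, are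
  invariant. Conversely, adjoin to the generated field \<open>K\<close> one after the other the variables
  \<open>x\<^sub>1, \<dots>, x\<^sub>m\<^sub>+\<^sub>1\<close> and then \<open>y\<^sub>1, \<dots>, y\<^sub>m\<close>, where \<open>y\<^sub>j = x\<^sub>2\<^sub>m\<^sub>+\<^sub>2\<^sub>-\<^sub>j\<close>. In each step the new
  variable \<open>w\<close> is a root of a monic polynomial over the previous field \<open>E\<close> whose degree is the size
  of a set \<open>U\<close>, and for each \<open>u \<in> U\<close> some element of \<open>G\<close> fixes \<open>E\<close> and maps \<open>w\<close> to \<open>w + u\<close>; hence
  an invariant in \<open>E(w)\<close> lies in \<open>E\<close>. For \<open>w = x\<^sub>i\<close> the set \<open>U\<close> is the span of \<open>x\<^sub>1, \<dots>, x\<^sub>i\<^sub>-\<^sub>1\<close>, and the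
  polynomial is \<open>\<Prod>\<^sub>u (T + u) - N(x\<^sub>i)\<close>. For \<open>w = y\<^sub>j\<close> the set \<open>U\<close> is the span of \<open>x\<^sub>j\<^sub>+\<^sub>1, \<dots>, x\<^sub>m\<close>. With
  \<open>e(T) = \<Sum>\<^sub>k w\<^sub>k T\<^bsup>q^k\<^esup>\<close> the monic additive polynomial vanishing on \<open>U\<close>, the product
  \<open>e(x\<^sub>j) e(y\<^sub>j) = \<Sum>\<^sub>i\<^sub>\<ge>\<^sub>j e(x\<^sub>i) e(y\<^sub>i)\<close> is a quadratic expression in the \<open>w\<^sub>k\<close> whose coefficients are
  Frobenius powers of the \<open>h\<^sub>k\<close> up to known terms. So \<open>e(y\<^sub>j)\<close> lies in \<open>E\<close>, and \<open>e(T) - e(y\<^sub>j)\<close> is the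
  required polynomial.
\<close>

section \<open>Subfields and a descent step\<close>

text \<open>Subfields are plain subsets of a field type, so that E(w) and the fixed field of a map
  live in one ambient field. Because \<open>inverse 0 = 0\<close>, closure under
  \<open>inverse\<close> has no exception at zero.\<close>

definition is_subfield :: "'b::field set \<Rightarrow> bool" where
  "is_subfield E \<longleftrightarrow> 0 \<in> E \<and> 1 \<in> E \<and> (\<forall>x\<in>E. \<forall>y\<in>E. x + y \<in> E \<and> x * y \<in> E) \<and>
     (\<forall>x\<in>E. - x \<in> E \<and> inverse x \<in> E)"

lemma
  assumes "is_subfield E"
  shows subfield_zero: "0 \<in> E" and subfield_one: "1 \<in> E"
    and subfield_add: "x \<in> E \<Longrightarrow> y \<in> E \<Longrightarrow> x + y \<in> E"
    and subfield_mult: "x \<in> E \<Longrightarrow> y \<in> E \<Longrightarrow> x * y \<in> E"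
    and subfield_uminus: "x \<in> E \<Longrightarrow> - x \<in> E"
    and subfield_inverse: "x \<in> E \<Longrightarrow> inverse x \<in> E"
  using assms by (auto simp: is_subfield_def)

lemma is_subfieldI:
  assumes "0 \<in> E" "1 \<in> E" "\<And>x y. x \<in> E \<Longrightarrow> y \<in> E \<Longrightarrow> x + y \<in> E"
    "\<And>x y. x \<in> E \<Longrightarrow> y \<in> E \<Longrightarrow> x * y \<in> E"
    "\<And>x. x \<in> E \<Longrightarrow> - x \<in> E" "\<And>x. x \<in> E \<Longrightarrow> inverse x \<in> E"
  shows "is_subfield E"
  using assms by (simp add: is_subfield_def)

lemma subfield_diff: "is_subfield E \<Longrightarrow> x \<in> E \<Longrightarrow> y \<in> E \<Longrightarrow> x - y \<in> E"
  by (metis diff_conv_add_uminus subfield_add subfield_uminus)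

lemma subfield_divide: "is_subfield E \<Longrightarrow> x \<in> E \<Longrightarrow> y \<in> E \<Longrightarrow> x / y \<in> E"
  by (simp add: divide_inverse subfield_inverse subfield_mult)

lemma subfield_power: "is_subfield E \<Longrightarrow> x \<in> E \<Longrightarrow> x ^ k \<in> E"
  by (induction k) (auto intro: subfield_one subfield_mult)

lemma subfield_sum: "is_subfield E \<Longrightarrow> (\<And>i. i \<in> A \<Longrightarrow> F i \<in> E) \<Longrightarrow> sum F A \<in> E"
  by (induction A rule: infinite_finite_induct) (auto intro: subfield_zero subfield_add)

lemma subfield_prod: "is_subfield E \<Longrightarrow> (\<And>i. i \<in> A \<Longrightarrow> F i \<in> E) \<Longrightarrow> prod F A \<in> E"
  by (induction A rule: infinite_finite_induct) (auto intro: subfield_one subfield_mult)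

section \<open>Polynomials with coefficients in a subfield\<close>

definition polys_over :: "'b::field set \<Rightarrow> 'b poly set" where
  "polys_over E = {p. \<forall>i. coeff p i \<in> E}"

lemma polys_over_coeff: "p \<in> polys_over E \<Longrightarrow> coeff p i \<in> E"
  by (simp add: polys_over_def)

lemma
  assumes "is_subfield E"
  shows polys_over_zero: "0 \<in> polys_over E"
    and polys_over_one: "1 \<in> polys_over E"
    and polys_over_add: "p \<in> polys_over E \<Longrightarrow> r \<in> polys_over E \<Longrightarrow> p + r \<in> polys_over E"
    and polys_over_diff: "p \<in> polys_over E \<Longrightarrow> r \<in> polys_over E \<Longrightarrow> p - r \<in> polys_over E"
    and polys_over_uminus: "p \<in> polys_over E \<Longrightarrow> - p \<in> polys_over E"
    and polys_over_smult: "c \<in> E \<Longrightarrow> p \<in> polys_over E \<Longrightarrow> smult c p \<in> polys_over E"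
    and polys_over_pCons: "c \<in> E \<Longrightarrow> p \<in> polys_over E \<Longrightarrow> pCons c p \<in> polys_over E"
    and polys_over_monom: "c \<in> E \<Longrightarrow> monom c k \<in> polys_over E"
    and polys_over_mult: "p \<in> polys_over E \<Longrightarrow> r \<in> polys_over E \<Longrightarrow> p * r \<in> polys_over E"
  using subfield_zero[OF assms] subfield_one[OF assms]
  by (simp_all add: polys_over_def subfield_add[OF assms] subfield_diff[OF assms]
      subfield_uminus[OF assms] subfield_mult[OF assms] subfield_sum[OF assms]
      coeff_pCons coeff_mult split: nat.split)

lemma polys_over_prod:
  "is_subfield E \<Longrightarrow> (\<And>i. i \<in> A \<Longrightarrow> F i \<in> polys_over E) \<Longrightarrow> prod F A \<in> polys_over E"
  by (induction A rule: infinite_finite_induct) (auto intro: polys_over_one polys_over_mult)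

lemma polys_over_sum:
  "is_subfield E \<Longrightarrow> (\<And>i. i \<in> A \<Longrightarrow> F i \<in> polys_over E) \<Longrightarrow> sum F A \<in> polys_over E"
  by (induction A rule: infinite_finite_induct) (auto intro: polys_over_zero polys_over_add)

text \<open>The set is the simple extension E(w), for \<open>w\<close> algebraic or transcendental:
  sums and products pass to the common denominator \<open>b * d\<close>, whose value at
  \<open>w\<close> is again nonzero.\<close>

lemma is_subfield_simple_extension:
  assumes E: "is_subfield E"
  shows "is_subfield {poly a w / poly b w | a b. a \<in> polys_over E \<and> b \<in> polys_over E \<and> poly b w \<noteq> 0}"
    (is "is_subfield ?K")
proof -
  note cl = polys_over_zero[OF E] polys_over_one[OF E] polys_over_add[OF E] polys_over_mult[OF E]
    polys_over_uminus[OF E]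
  have I: "poly a w / poly b w \<in> ?K"
    if "a \<in> polys_over E" "b \<in> polys_over E" "poly b w \<noteq> 0" for a b
    using that by blast
  have zero: "0 \<in> ?K" using I[of 0 1] cl by simp
  have one: "1 \<in> ?K" using I[of 1 1] cl by simp
  have add_mult: "x + y \<in> ?K" "x * y \<in> ?K" if "x \<in> ?K" "y \<in> ?K" for x y
  proof -
    from that obtain a b c d where *: "x = poly a w / poly b w" "y = poly c w / poly d w"
      "poly b w \<noteq> 0" "poly d w \<noteq> 0"
      "a \<in> polys_over E" "b \<in> polys_over E" "c \<in> polys_over E" "d \<in> polys_over E" by blast
    have "x + y = poly (a * d + c * b) w / poly (b * d) w" "x * y = poly (a * c) w / poly (b * d) w"
      using * by (simp_all add: add_frac_eq)
    with * cl I[of "a * d + c * b" "b * d"] I[of "a * c" "b * d"]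
    show "x + y \<in> ?K" "x * y \<in> ?K" by auto
  qed
  have inv: "- x \<in> ?K" "inverse x \<in> ?K" if x: "x \<in> ?K" for x
  proof -
    from x obtain a b where *: "x = poly a w / poly b w" "poly b w \<noteq> 0"
      "a \<in> polys_over E" "b \<in> polys_over E" by blast
    have "- x = poly (- a) w / poly b w" using * by simp
    moreover have "inverse x = poly b w / poly a w" using * by simp
    ultimately have "- x \<in> ?K \<and> inverse x \<in> ?K"
      using * cl I[of "- a" b] I[of b a] zero by (cases "poly a w = 0") auto
    then show "- x \<in> ?K" "inverse x \<in> ?K" by blast+
  qed
  show ?thesis by (rule is_subfieldI) (fact zero one add_mult inv)+
qed

text \<open>Division with remainder in Horner form: prepending a coefficient to a remainder raises
  its degree to at most that of \<open>\<psi>\<close>, and one subtraction brings it down again. As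
  \<open>\<psi>\<close> is monic, nothing is divided and the coefficients remain in
  \<open>E\<close>.\<close>

lemma reduce_mod_monic:
  assumes E: "is_subfield E" and \<psi>: "\<psi> \<in> polys_over E" "lead_coeff \<psi> = 1" "degree \<psi> > 0"
    and w: "poly \<psi> w = 0" and "P \<in> polys_over E"
  obtains R where "R \<in> polys_over E" "degree R < degree \<psi>" "poly R w = poly P w"
proof -
  have "\<exists>R. R \<in> polys_over E \<and> degree R < degree \<psi> \<and> poly R w = poly P w"
    using assms(6)
  proof (induction P)
    case 0
    then show ?case using \<psi> by (intro exI[of _ 0]) auto
  next
    case (pCons a P)
    have "a \<in> E" "P \<in> polys_over E"
      using pCons.prems unfolding polys_over_def
      by (auto simp: coeff_pCons split: nat.splits)
    with pCons.IH obtain R where R: "R \<in> polys_over E" "degree R < degree \<psi>" "poly R w = poly P w"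
      by blast
    define S where "S = pCons a R - smult (coeff (pCons a R) (degree \<psi>)) \<psi>"
    have "S \<in> polys_over E"
      unfolding S_def using \<open>a \<in> E\<close> R(1) E \<psi>(1)
      by (intro polys_over_diff polys_over_smult polys_over_pCons polys_over_coeff)
    moreover have "degree S < degree \<psi>"
    proof (rule degree_lessI)
      show "S \<noteq> 0 \<or> degree \<psi> > 0" using \<psi> by simp
      have "coeff S k = 0" if "k \<ge> degree \<psi>" for k
      proof (cases "k = degree \<psi>")
        case True
        then show ?thesis using \<psi> by (simp add: S_def)
      next
        case False
        then have "degree \<psi> < k" "degree (pCons a R) < k"
          using that R(2) degree_pCons_le[of a R] by linarith+
        then show ?thesis by (simp add: S_def coeff_eq_0)
      qed
      then show "\<forall>k\<ge>degree \<psi>. coeff S k = 0" by blast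
    qed
    moreover have "poly S w = poly (pCons a P) w"
      using w R(3) by (simp add: S_def)
    ultimately show ?case by blast
  qed
  then show ?thesis using that by blast
qed

section \<open>Endomorphisms of a field and their fixed elements\<close>

definition ring_endo :: "('b::field \<Rightarrow> 'b) \<Rightarrow> bool" where
  "ring_endo \<sigma> \<longleftrightarrow> (\<forall>x y. \<sigma> (x + y) = \<sigma> x + \<sigma> y \<and> \<sigma> (x * y) = \<sigma> x * \<sigma> y) \<and> \<sigma> 1 = 1"

lemma
  assumes "ring_endo \<sigma>"
  shows ring_endo_add: "\<sigma> (x + y) = \<sigma> x + \<sigma> y"
    and ring_endo_mult: "\<sigma> (x * y) = \<sigma> x * \<sigma> y"
    and ring_endo_one: "\<sigma> 1 = 1"
  using assms by (auto simp: ring_endo_def)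

lemma ring_endo_zero: "ring_endo \<sigma> \<Longrightarrow> \<sigma> 0 = 0"
  by (metis add_cancel_right_left ring_endo_add)

lemma ring_endo_uminus: "ring_endo \<sigma> \<Longrightarrow> \<sigma> (- x) = - \<sigma> x"
  by (metis add.inverse_unique add.right_inverse ring_endo_add ring_endo_zero)

lemma ring_endo_inverse: "ring_endo \<sigma> \<Longrightarrow> \<sigma> (inverse x) = inverse (\<sigma> x)"
proof (cases "x = 0")
  case False
  then have "\<sigma> x * \<sigma> (inverse x) = 1" if "ring_endo \<sigma>"
    using that by (simp add: ring_endo_one flip: ring_endo_mult)
  then show "ring_endo \<sigma> \<Longrightarrow> ?thesis" by (metis inverse_unique)
qed (simp add: ring_endo_zero)

lemma is_subfield_fixed: "ring_endo \<sigma> \<Longrightarrow> is_subfield {x. \<sigma> x = x}"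
  by (simp add: is_subfield_def ring_endo_zero ring_endo_one ring_endo_add ring_endo_mult
      ring_endo_uminus ring_endo_inverse)

lemma ring_endo_poly:
  assumes "ring_endo \<sigma>" "\<And>x. x \<in> E \<Longrightarrow> \<sigma> x = x" "P \<in> polys_over E"
  shows "\<sigma> (poly P w) = poly P (\<sigma> w)"
proof -
  have "\<forall>i. \<sigma> (coeff P i) = coeff P i" using assms by (simp add: polys_over_def)
  then show ?thesis
  proof (induction P)
    case (pCons a P)
    have "\<sigma> a = a" "\<forall>i. \<sigma> (coeff P i) = coeff P i"
      using pCons.prems by (metis coeff_pCons_0, metis coeff_pCons_Suc)
    with pCons.IH show ?case by (simp add: ring_endo_add ring_endo_mult assms(1))
  qed (simp add: ring_endo_zero assms(1))
qed

text \<open>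
  Reducing numerator and denominator of \<open>f\<close> modulo \<open>\<psi>\<close> gives polynomials \<open>r\<close>, \<open>s\<close> of degree less
  than \<open>card U\<close>; the polynomial \<open>r - f s\<close> vanishes at all conjugates \<open>w + u\<close>, so \<open>r = f s\<close>
  coefficientwise.
\<close>

lemma descent_step:
  fixes w f :: "'b::field"
  assumes E: "is_subfield E"
    and \<psi>: "\<psi> \<in> polys_over E" "lead_coeff \<psi> = 1" "degree \<psi> = card U" "poly \<psi> w = 0"
    and U: "finite U" "U \<noteq> {}"
    and f: "a \<in> polys_over E" "b \<in> polys_over E" "poly b w \<noteq> 0" "f = poly a w / poly b w"
    and \<sigma>: "\<And>u. u \<in> U \<Longrightarrow> \<exists>\<sigma>. ring_endo \<sigma> \<and> (\<forall>x\<in>E. \<sigma> x = x) \<and> \<sigma> f = f \<and> \<sigma> w = w + u"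
  shows "f \<in> E"
proof -
  have pos: "degree \<psi> > 0" using U \<psi> by (simp add: card_gt_0_iff)
  obtain r where r: "r \<in> polys_over E" "degree r < degree \<psi>" "poly r w = poly a w"
    using reduce_mod_monic[OF E \<psi>(1,2) pos \<psi>(4) f(1)] .
  obtain s where s: "s \<in> polys_over E" "degree s < degree \<psi>" "poly s w = poly b w"
    using reduce_mod_monic[OF E \<psi>(1,2) pos \<psi>(4) f(2)] .
  have rs: "poly r w = f * poly s w" using r s f by simp
  have card: "card ((+) w ` U) = card U"
    by (rule card_image) simp
  have "r = smult f s"
  proof (rule poly_eqI_degree[of "(+) w ` U"])
    fix x assume "x \<in> (+) w ` U"
    then obtain u where u: "u \<in> U" "x = w + u" by blast
    obtain \<sigma> where s': "ring_endo \<sigma>" "\<forall>x\<in>E. \<sigma> x = x" "\<sigma> f = f" "\<sigma> w = w + u"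
      using \<sigma>[OF u(1)] by blast
    have "poly r x = \<sigma> (poly r w)"
      using ring_endo_poly[of \<sigma> E r w] s' r(1) u by simp
    also have "\<dots> = f * \<sigma> (poly s w)"
      using s' by (simp add: rs ring_endo_mult)
    also have "\<sigma> (poly s w) = poly s x"
      using ring_endo_poly[of \<sigma> E s w] s' s(1) u by simp
    finally show "poly r x = poly (smult f s) x" by simp
  next
    show "card ((+) w ` U) > degree r" "card ((+) w ` U) > degree (smult f s)"
      using r s \<psi>(3) degree_smult_le[of f s] by (auto simp: card)
  qed
  moreover have "s \<noteq> 0" using s f by auto
  \<comment> \<open>For \<open>f \<noteq> 0\<close> the polynomials \<open>r\<close> and
    \<open>s\<close> have the same degree, so \<open>f\<close> is the quotient of their leading
    coefficients, both in \<open>E\<close>.\<close>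
  ultimately have "f = lead_coeff r / coeff s (degree r)" if "f \<noteq> 0"
    using that by simp
  then show ?thesis
    using E r(1) s(1) by (cases "f = 0") (auto intro: subfield_zero subfield_divide polys_over_coeff)
qed


section \<open>The Frobenius map and additive polynomials\<close>

text \<open>Multiplication by a nonzero \<open>x\<close> permutes the nonzero elements; comparing
  the products of all of them gives x^(q-1) = 1.\<close>

lemma finite_field_power_card:
  fixes x :: "'a::{field, finite}"
  shows "x ^ CARD('a) = x"
proof (cases "x = 0")
  case False
  have "(\<Prod>y\<in>UNIV - {0}. x * y) = \<Prod>(UNIV - {0})"
    by (rule prod.reindex_bij_witness[of _ "\<lambda>y. y / x" "\<lambda>y. x * y"]) (use False in auto)
  moreover have "\<Prod>(UNIV - {0 :: 'a}) \<noteq> 0" by (subst prod_zero_iff) auto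
  ultimately have "x ^ (CARD('a) - 1) = 1"
    by (simp add: prod.distrib card_Diff_singleton)
  moreover have "CARD('a) = Suc (CARD('a) - 1)" by simp
  ultimately show ?thesis by (metis power_Suc mult.right_neutral)
qed simp

lemma card_field_ge_2: "CARD('a::{field, finite}) \<ge> 2"
  using card_mono[of UNIV "{0, 1 :: 'a}"] by simp

text \<open>Translation by 1 preserves the sum of all field elements, so q = 0 in the field, which
  is incompatible with 2 = 0 for odd q. Conversely, for even q, -1 = (-1)^q = 1. This links the case
  split in \<open>sylow_G\<close> to the characteristic.\<close>

lemma even_card_iff: "even CARD('a::{field, finite}) \<longleftrightarrow> (2 :: 'a) = 0"
proof
  assume two: "(2 :: 'a) = 0"
  have "(\<Sum>x\<in>UNIV. x + 1) = (\<Sum>x\<in>UNIV. x :: 'a)"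
    by (rule sum.reindex_bij_witness[of _ "\<lambda>x. x - 1" "\<lambda>x. x + 1"]) auto
  then have card: "of_nat CARD('a) = (0 :: 'a)" by (simp add: sum.distrib)
  show "even CARD('a)"
  proof (rule ccontr)
    assume "odd CARD('a)"
    then obtain k where "CARD('a) = 2 * k + 1" by (rule oddE)
    then have "of_nat CARD('a) = (1 :: 'a)" using two by simp
    with card show False by simp
  qed
next
  assume "even CARD('a)"
  then have "(- 1 :: 'a) = 1" using finite_field_power_card[of "- 1 :: 'a"] by simp
  then have "(1 :: 'a) + 1 = 0" by (metis add.right_inverse)
  then show "(2 :: 'a) = 0" by simp
qed

text \<open>An embedding of F_q into a field. It is used with \<open>id\<close>, for vectors over
  F_q, and with \<open>rconst\<close>, for the constants among the rational functions, so that each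
  matrix computation is done once for both.\<close>

locale scalars =
  fixes \<kappa> :: "'a::{field, finite} \<Rightarrow> 'b::field"
  assumes scalar_add: "\<kappa> (c + d) = \<kappa> c + \<kappa> d"
    and scalar_mult: "\<kappa> (c * d) = \<kappa> c * \<kappa> d"
    and scalar_one: "\<kappa> 1 = 1"
begin

lemma scalar_zero: "\<kappa> 0 = 0"
  by (metis add_cancel_right_left scalar_add)

lemma scalar_uminus: "\<kappa> (- c) = - \<kappa> c"
  by (metis add.inverse_unique add.right_inverse scalar_add scalar_zero)

lemma scalar_diff: "\<kappa> (c - d) = \<kappa> c - \<kappa> d"
  by (metis diff_conv_add_uminus scalar_add scalar_uminus)

lemma scalar_sum: "\<kappa> (sum F A) = (\<Sum>i\<in>A. \<kappa> (F i))"
  by (induction A rule: infinite_finite_induct) (simp_all add: scalar_zero scalar_add)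

lemma scalar_power: "\<kappa> (c ^ k) = \<kappa> c ^ k"
  by (induction k) (simp_all add: scalar_one scalar_mult)

lemma scalar_eq_0_iff: "\<kappa> c = 0 \<longleftrightarrow> c = 0"
proof
  show "c = 0" if "\<kappa> c = 0"
  proof (rule ccontr)
    assume "c \<noteq> 0"
    then have "\<kappa> c * \<kappa> (inverse c) = 1" by (simp add: scalar_one flip: scalar_mult)
    then show False using that by simp
  qed
qed (simp add: scalar_zero)

lemma inj_scalar: "inj \<kappa>"
  by (rule injI) (metis eq_iff_diff_eq_0 scalar_diff scalar_eq_0_iff)

lemma card_range_scalar: "card (range \<kappa>) = CARD('a)"
  by (rule card_image) (rule inj_scalar)

lemma frobenius_scalar: "\<kappa> c ^ CARD('a) = \<kappa> c"
  by (metis finite_field_power_card scalar_power)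

text \<open>As polynomials in \<open>s\<close>, both sides are monic of degree q and vanish at the q
  scalars.\<close>

lemma frobenius_eq_prod: "s ^ CARD('a) - s = (\<Prod>c\<in>UNIV. s - \<kappa> c)"
proof -
  let ?q = "CARD('a)"
  have q: "?q \<ge> 2" by (rule card_field_ge_2)
  have "(\<Prod>c\<in>UNIV. [:- \<kappa> c, 1:]) = monom 1 ?q - monom 1 1"
  proof (rule poly_eqI_degree_lead_coeff[where n = ?q and A = "range \<kappa>"])
    have deg: "degree (\<Prod>c\<in>UNIV. [:- \<kappa> c, 1:]) = ?q"
      by (simp add: degree_prod_eq_sum_degree)
    then show "degree (\<Prod>c\<in>UNIV. [:- \<kappa> c, 1:]) \<le> ?q" by simp
    have "lead_coeff (\<Prod>c\<in>UNIV. [:- \<kappa> c, 1:]) = 1"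
      by (simp add: lead_coeff_prod)
    then show "coeff (\<Prod>c\<in>UNIV. [:- \<kappa> c, 1:]) ?q = coeff (monom 1 ?q - monom 1 1) ?q"
      using q by (simp add: deg)
    show "degree (monom 1 ?q - monom 1 1 :: 'b poly) \<le> ?q"
      using q by (intro degree_diff_le) (auto simp: degree_monom_eq)
    fix z assume "z \<in> range \<kappa>"
    then obtain c where z: "z = \<kappa> c" by blast
    have "poly (\<Prod>c\<in>UNIV. [:- \<kappa> c, 1:]) z = 0"
      by (auto simp: poly_prod z)
    then show "poly (\<Prod>c\<in>UNIV. [:- \<kappa> c, 1:]) z = poly (monom 1 ?q - monom 1 1) z"
      by (simp add: poly_monom z frobenius_scalar)
  qed (simp add: card_range_scalar)
  then have "poly (\<Prod>c\<in>UNIV. [:- \<kappa> c, 1:]) s = poly (monom 1 ?q - monom 1 1) s" by simp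
  then show ?thesis by (simp add: poly_prod poly_monom)
qed

text \<open>Instead of binomial coefficients, polynomial identity: (s + T)^q and s^q + T^q are monic
  of degree q in T and agree at the q scalars.\<close>

lemma frobenius_add:
  fixes s t :: 'b
  shows "(s + t) ^ CARD('a) = s ^ CARD('a) + t ^ CARD('a)"
proof -
  let ?q = "CARD('a)"
  have q: "?q \<ge> 2" by (rule card_field_ge_2)
  \<comment> \<open>The product formula for s^q - s is unchanged when \<open>s\<close> is translated
    by a scalar, since this only permutes the factors.\<close>
  have shift: "(s + \<kappa> c) ^ ?q = s ^ ?q + \<kappa> c" for c
  proof -
    have "(\<Prod>d\<in>UNIV. s + \<kappa> c - \<kappa> d) = (\<Prod>d\<in>UNIV. s - \<kappa> d)"
      by (rule prod.reindex_bij_witness[of _ "\<lambda>d. d + c" "\<lambda>d. d - c"])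
        (simp_all add: scalar_diff scalar_add algebra_simps)
    then have "(s + \<kappa> c) ^ ?q - (s + \<kappa> c) = s ^ ?q - s"
      by (simp add: frobenius_eq_prod)
    then show ?thesis by (simp add: algebra_simps)
  qed
  have "[:s, 1:] ^ ?q = [:s ^ ?q:] + monom 1 ?q"
  proof (rule poly_eqI_degree_lead_coeff[where n = ?q and A = "range \<kappa>"])
    have deg: "degree ([:s, 1:] ^ ?q) = ?q" by (simp add: degree_power_eq)
    then show "degree ([:s, 1:] ^ ?q) \<le> ?q" by simp
    have "lead_coeff ([:s, 1:] ^ ?q) = 1" by (simp add: lead_coeff_power)
    moreover have "coeff [:s ^ ?q:] ?q = 0" by (rule coeff_eq_0) simp
    ultimately show "coeff ([:s, 1:] ^ ?q) ?q = coeff ([:s ^ ?q:] + monom 1 ?q) ?q"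
      by (simp add: deg)
    show "degree ([:s ^ ?q:] + monom 1 ?q) \<le> ?q"
      by (intro degree_add_le) (auto simp: degree_monom_eq)
    fix z assume "z \<in> range \<kappa>"
    then show "poly ([:s, 1:] ^ ?q) z = poly ([:s ^ ?q:] + monom 1 ?q) z"
      by (auto simp: poly_monom shift frobenius_scalar)
  qed (simp add: card_range_scalar)
  then have "poly ([:s, 1:] ^ ?q) t = poly ([:s ^ ?q:] + monom 1 ?q) t" by simp
  then show ?thesis by (simp add: poly_monom)
qed

lemma frobenius_power_add:
  fixes s t :: 'b
  shows "(s + t) ^ (CARD('a) ^ k) = s ^ (CARD('a) ^ k) + t ^ (CARD('a) ^ k)"
  by (induction k arbitrary: s t) (simp_all add: power_mult frobenius_add)

lemma frobenius_power_sum: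
  fixes F :: "'i \<Rightarrow> 'b"
  shows "sum F A ^ (CARD('a) ^ k) = (\<Sum>i\<in>A. F i ^ (CARD('a) ^ k))"
  by (induction A rule: infinite_finite_induct) (simp_all add: frobenius_power_add)

lemma frobenius_power_scalar: "\<kappa> c ^ (CARD('a) ^ k) = \<kappa> c"
  by (induction k) (simp_all add: power_mult frobenius_scalar)

text \<open>A q-linearised polynomial: evaluation is F_q-linear
  (\<open>poly_additive_poly_sum\<close>), so its roots form an F_q-space.\<close>

definition additive_poly :: "(nat \<Rightarrow> 'b) \<Rightarrow> nat \<Rightarrow> 'b poly" where
  "additive_poly w r = (\<Sum>k\<le>r. monom (w k) (CARD('a) ^ k))"

lemma poly_additive_poly: "poly (additive_poly w r) t = (\<Sum>k\<le>r. w k * t ^ (CARD('a) ^ k))"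
  by (simp add: additive_poly_def poly_sum poly_monom)

lemma additive_poly_in: "is_subfield E \<Longrightarrow> (\<And>k. w k \<in> E) \<Longrightarrow> additive_poly w r \<in> polys_over E"
  unfolding additive_poly_def by (intro polys_over_sum polys_over_monom)

lemma coeff_additive_poly_top: "coeff (additive_poly w r) (CARD('a) ^ r) = w r"
proof -
  have "coeff (additive_poly w r) (CARD('a) ^ r) = (\<Sum>k\<le>r. if k = r then w k else 0)"
    unfolding additive_poly_def coeff_sum using card_field_ge_2[where ?'a = 'a]
    by (intro sum.cong) auto
  then show ?thesis by simp
qed

lemma degree_additive_poly:
  assumes "w r = 1"
  shows "degree (additive_poly w r) = CARD('a) ^ r"
proof (rule antisym)
  show "degree (additive_poly w r) \<le> CARD('a) ^ r"
    unfolding additive_poly_def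
  proof (intro degree_sum_le)
    fix k assume "k \<in> {..r}"
    then have "CARD('a) ^ k \<le> CARD('a) ^ r"
      using card_field_ge_2[where ?'a = 'a] by (intro power_increasing) auto
    then show "degree (monom (w k) (CARD('a) ^ k)) \<le> CARD('a) ^ r"
      by (rule order_trans[OF degree_monom_le])
  qed simp
  show "CARD('a) ^ r \<le> degree (additive_poly w r)"
    by (rule le_degree) (simp add: coeff_additive_poly_top assms)
qed

lemma lead_coeff_additive_poly: "w r = 1 \<Longrightarrow> lead_coeff (additive_poly w r) = 1"
  by (simp add: degree_additive_poly coeff_additive_poly_top)

lemma poly_additive_poly_add:
  "poly (additive_poly w r) (s + t) = poly (additive_poly w r) s + poly (additive_poly w r) t"
  by (simp add: poly_additive_poly frobenius_power_add algebra_simps sum.distrib)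

lemma poly_additive_poly_scalar:
  "poly (additive_poly w r) (\<kappa> c * t) = \<kappa> c * poly (additive_poly w r) t"
  by (simp add: poly_additive_poly power_mult_distrib frobenius_power_scalar sum_distrib_left
      algebra_simps)

lemma poly_additive_poly_sum:
  "poly (additive_poly w r) (\<Sum>i\<in>A. \<kappa> (c i) * F i) = (\<Sum>i\<in>A. \<kappa> (c i) * poly (additive_poly w r) (F i))"
proof (induction A rule: infinite_finite_induct)
  case (infinite A)
  then show ?case using poly_additive_poly_scalar[of w r 0 0] by (simp add: scalar_zero)
next
  case empty
  then show ?case using poly_additive_poly_scalar[of w r 0 0] by (simp add: scalar_zero)
qed (simp add: poly_additive_poly_add poly_additive_poly_scalar)

text \<open>
  Adjoining a vector \<open>v\<close> to the kernel of the additive polynomial \<open>e\<close> replaces \<open>e\<close> by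
  \<open>e\<^sup>q - e(v)\<^sup>q\<^sup>-\<^sup>1 e\<close>.
\<close>

lemma additive_poly_vanishing:
  assumes E: "is_subfield E" and "set vs \<subseteq> E"
  shows "\<exists>w. (\<forall>k. w k \<in> E) \<and> w (length vs) = 1 \<and>
           (\<forall>v\<in>set vs. poly (additive_poly w (length vs)) v = 0)"
  using assms(2)
proof (induction vs)
  case Nil
  show ?case using subfield_one[OF E] by (intro exI[of _ "\<lambda>_. 1"]) simp
next
  case (Cons v vs)
  let ?r = "length vs"
  from Cons obtain w where w: "\<And>k. w k \<in> E" "w ?r = 1"
    "\<And>v. v \<in> set vs \<Longrightarrow> poly (additive_poly w ?r) v = 0" by auto
  define a where "a = poly (additive_poly w ?r) v"
  \<comment> \<open>The coefficients of e^q - a^(q-1) e: the q-th power moves coefficient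
    \<open>k - 1\<close> to place \<open>k\<close>, and the guard \<open>k \<le> ?r\<close> cuts off
    the values of \<open>w\<close> that do not belong to e.\<close>
  define w' where "w' k = (if k = 0 then 0 else w (k - 1) ^ CARD('a)) -
      a ^ (CARD('a) - 1) * (if k \<le> ?r then w k else 0)" for k
  have "v \<in> E" using Cons.prems by simp
  then have "a \<in> E"
    unfolding a_def poly_additive_poly using E w(1)
    by (intro subfield_sum subfield_mult subfield_power)
  then have in_E: "w' k \<in> E" for k
    unfolding w'_def using E w(1) subfield_zero[OF E] \<open>a \<in> E\<close>
    by (intro subfield_diff subfield_mult subfield_power) (auto intro: subfield_power)
  have top: "w' (Suc ?r) = 1" by (simp add: w'_def w(2))
  have step: "poly (additive_poly w' (Suc ?r)) t = poly (additive_poly w ?r) t ^ CARD('a)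
      - a ^ (CARD('a) - 1) * poly (additive_poly w ?r) t" for t
  proof -
    let ?q = "CARD('a)"
    have "(\<Sum>k\<le>Suc ?r. (if k = 0 then 0 else w (k - 1) ^ ?q) * t ^ (?q ^ k))
        = (\<Sum>k\<le>?r. w k ^ ?q * t ^ (?q ^ Suc k))"
      by (subst sum.atMost_Suc_shift) simp
    also have "\<dots> = poly (additive_poly w ?r) t ^ ?q"
      using frobenius_power_sum[of "\<lambda>k. w k * t ^ (?q ^ k)" "{..?r}" 1]
      by (simp add: poly_additive_poly power_mult_distrib mult.commute flip: power_mult)
    finally have 1: "(\<Sum>k\<le>Suc ?r. (if k = 0 then 0 else w (k - 1) ^ ?q) * t ^ (?q ^ k))
        = poly (additive_poly w ?r) t ^ ?q" .
    have 2: "(\<Sum>k\<le>Suc ?r. a ^ (?q - 1) * (if k \<le> ?r then w k else 0) * t ^ (?q ^ k))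
        = a ^ (?q - 1) * poly (additive_poly w ?r) t"
      by (simp add: poly_additive_poly sum_distrib_left mult.assoc)
    show ?thesis
      unfolding poly_additive_poly[of w'] w'_def left_diff_distrib sum_subtractf 1 2 ..
  qed
  \<comment> \<open>At \<open>v\<close> the new polynomial has the value a^q - a^(q-1) a. At the
    earlier vectors e itself is already zero.\<close>
  have "a ^ CARD('a) = a ^ (CARD('a) - 1) * a"
    by (metis One_nat_def Suc_pred mult.commute power_Suc zero_less_card_finite)
  then have "poly (additive_poly w' (Suc ?r)) v = 0"
    by (simp add: step flip: a_def)
  moreover have "poly (additive_poly w' (Suc ?r)) u = 0" if "u \<in> set vs" for u
    using w(3)[OF that] by (simp add: step)
  ultimately show ?case
    using in_E top by (intro exI[of _ w']) auto
qed

section \<open>Finite spans over F_q\<close>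

definition lin_span :: "('i \<Rightarrow> 'b) \<Rightarrow> 'i set \<Rightarrow> 'b set" where
  "lin_span x I = {\<Sum>l\<in>I. \<kappa> (c l) * x l | c. True}"

lemma lin_spanI: "(\<Sum>l\<in>I. \<kappa> (c l) * x l) \<in> lin_span x I"
  by (auto simp: lin_span_def)

definition lin_indep :: "('i \<Rightarrow> 'b) \<Rightarrow> 'i set \<Rightarrow> bool" where
  "lin_indep x I \<longleftrightarrow> (\<forall>c. (\<Sum>l\<in>I. \<kappa> (c l) * x l) = 0 \<longrightarrow> (\<forall>l\<in>I. c l = 0))"

text \<open>Restricting the coefficient functions to extensional ones makes the parameter set
  finite, of size q^|I|, which gives finiteness and, under independence, the cardinality of the
  span.\<close>

lemma lin_span_eq_image:
  "lin_span x I = (\<lambda>c. \<Sum>l\<in>I. \<kappa> (c l) * x l) ` (I \<rightarrow>\<^sub>E UNIV)"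
proof -
  have "(\<Sum>l\<in>I. \<kappa> (c l) * x l) \<in> (\<lambda>c. \<Sum>l\<in>I. \<kappa> (c l) * x l) ` (I \<rightarrow>\<^sub>E UNIV)" for c
    by (rule image_eqI[of _ _ "restrict c I"]) auto
  then show ?thesis unfolding lin_span_def by auto
qed

lemma finite_lin_span: "finite I \<Longrightarrow> finite (lin_span x I)"
  unfolding lin_span_eq_image by (intro finite_imageI finite_PiE) auto

lemma card_lin_span:
  assumes "finite I" "lin_indep x I"
  shows "card (lin_span x I) = CARD('a) ^ card I"
proof -
  have "inj_on (\<lambda>c. \<Sum>l\<in>I. \<kappa> (c l) * x l) (I \<rightarrow>\<^sub>E UNIV)"
  proof (rule inj_onI)
    fix c d :: "'c \<Rightarrow> 'a"
    assume cd: "c \<in> I \<rightarrow>\<^sub>E UNIV" "d \<in> I \<rightarrow>\<^sub>E UNIV"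
      and "(\<Sum>l\<in>I. \<kappa> (c l) * x l) = (\<Sum>l\<in>I. \<kappa> (d l) * x l)"
    then have "(\<Sum>l\<in>I. \<kappa> (c l - d l) * x l) = 0"
      by (simp add: scalar_diff left_diff_distrib sum_subtractf)
    then have "\<forall>l\<in>I. c l - d l = 0"
      using assms(2) unfolding lin_indep_def by (elim allE[of _ "\<lambda>l. c l - d l"]) simp
    then show "c = d" using cd by (intro PiE_ext) auto
  qed
  then show ?thesis
    unfolding lin_span_eq_image by (simp add: card_image card_PiE assms(1))
qed

text \<open>The span already supplies q^r roots with r = \<open>card I\<close>, as many as the
  degree allows, so a root outside it would be one too many.\<close>

lemma additive_poly_nonzero:
  assumes I: "finite I" "lin_indep x I" and w: "w (card I) = 1"
    and van: "\<And>i. i \<in> I \<Longrightarrow> poly (additive_poly w (card I)) (x i) = 0"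
    and t: "t \<notin> lin_span x I"
  shows "poly (additive_poly w (card I)) t \<noteq> 0"
proof
  let ?e = "additive_poly w (card I)"
  assume "poly ?e t = 0"
  moreover have "poly ?e u = 0" if "u \<in> lin_span x I" for u
    using that unfolding lin_span_def by (auto simp: poly_additive_poly_sum van)
  ultimately have sub: "insert t (lin_span x I) \<subseteq> {u. poly ?e u = 0}" by auto
  have nz: "?e \<noteq> 0" using lead_coeff_additive_poly[of w, OF w] by auto
  have "Suc (CARD('a) ^ card I) = card (insert t (lin_span x I))"
    using t I by (simp add: finite_lin_span card_lin_span)
  also have "\<dots> \<le> card {u. poly ?e u = 0}"
    by (rule card_mono[OF poly_roots_finite[OF nz] sub])
  also have "\<dots> \<le> degree ?e" by (rule card_poly_roots_bound[OF nz])
  finally show False by (simp add: degree_additive_poly w)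
qed

end

text \<open>The weights are symmetric in \<open>k\<close> and \<open>l\<close>, so off-diagonal
  terms can be collected in pairs; only the pair sums \<open>B k l + B l k\<close>, not the single
  entries, are known to lie in \<open>E\<close>. The induction splits off the last row and column
  together.\<close>

lemma symmetric_sum_in_subfield:
  fixes r :: nat
  assumes E: "is_subfield E"
    and w: "\<And>k. w k \<in> E"
    and "\<And>k. k \<le> r \<Longrightarrow> B k k \<in> E"
    and "\<And>k l. k < l \<Longrightarrow> l \<le> r \<Longrightarrow> B k l + B l k \<in> E"
  shows "(\<Sum>k\<le>r. \<Sum>l\<le>r. w k * w l * B k l) \<in> E"
  using assms(3,4)
proof (induction r)
  case 0
  then show ?case using E w by (auto intro: subfield_mult)
next
  case (Suc r)
  let ?n = "Suc r"
  have "(\<Sum>k\<le>?n. \<Sum>l\<le>?n. w k * w l * B k l) = (\<Sum>k\<le>r. \<Sum>l\<le>r. w k * w l * B k l)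
      + (\<Sum>k\<le>r. w k * w ?n * (B k ?n + B ?n k)) + w ?n * w ?n * B ?n ?n"
    by (simp add: sum.distrib algebra_simps)
  moreover have "(\<Sum>k\<le>r. \<Sum>l\<le>r. w k * w l * B k l) \<in> E" using Suc by simp
  moreover have "(\<Sum>k\<le>r. w k * w ?n * (B k ?n + B ?n k)) \<in> E"
    using E w Suc.prems(2)[of _ ?n] by (intro subfield_sum subfield_mult) auto
  moreover have "w ?n * w ?n * B ?n ?n \<in> E"
    using E w Suc.prems(1)[of ?n] by (intro subfield_mult) auto
  ultimately show ?case using E by (simp only: subfield_add)
qed

context scalars
begin

text \<open>
  The pairings \<open>B\<^sub>k\<^sub>l = \<Sum>\<^sub>i x\<^sub>i\<^bsup>q^k\<^esup> y\<^sub>i\<^bsup>q^l\<^esup>\<close> are alternating modulo \<open>E\<close>, so the quadratic expression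
  \<open>\<Sum>\<^sub>k\<^sub>l w\<^sub>k w\<^sub>l B\<^sub>k\<^sub>l = \<Sum>\<^sub>i e(x\<^sub>i) e(y\<^sub>i)\<close> lies in \<open>E\<close>.
\<close>

lemma sum_additive_poly_products_in_subfield:
  fixes x y :: "'i \<Rightarrow> 'b"
  assumes E: "is_subfield E" and w: "\<And>k. w k \<in> E"
    and diag: "(\<Sum>i\<in>I. x i * y i) \<in> E"
    and alt: "\<And>k. 1 \<le> k \<Longrightarrow> k \<le> r \<Longrightarrow>
      (\<Sum>i\<in>I. x i * y i ^ (CARD('a) ^ k) + x i ^ (CARD('a) ^ k) * y i) \<in> E"
  shows "(\<Sum>i\<in>I. poly (additive_poly w r) (x i) * poly (additive_poly w r) (y i)) \<in> E"
proof -
  let ?q = "CARD('a)"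
  define B where "B k l = (\<Sum>i\<in>I. x i ^ (?q ^ k) * y i ^ (?q ^ l))" for k l
  \<comment> \<open>Frobenius moves both indices at once, so every diagonal entry is a power of
    \<open>B 0 0\<close> and every pair sum a power of one with an index 0; these are the two kinds
    of sums assumed to lie in \<open>E\<close>.\<close>
  have frob: "B (k + a) (k + b) = B a b ^ (?q ^ k)" for k a b
    by (simp add: B_def frobenius_power_sum power_mult_distrib power_add mult.commute
        flip: power_mult)
  have "B k k \<in> E" for k
    using frob[of k 0 0] diag E by (simp add: B_def subfield_power)
  moreover have "B k l + B l k \<in> E" if kl: "k < l" "l \<le> r" for k l
  proof -
    have "B k l + B l k = (B 0 (l - k) + B (l - k) 0) ^ (?q ^ k)"
      using frob[of k 0 "l - k"] frob[of k "l - k" 0] kl by (simp add: frobenius_power_add)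
    moreover have "B 0 (l - k) + B (l - k) 0 \<in> E"
      using alt[of "l - k"] kl by (simp add: B_def sum.distrib)
    ultimately show ?thesis using E by (simp add: subfield_power)
  qed
  ultimately have "(\<Sum>k\<le>r. \<Sum>l\<le>r. w k * w l * B k l) \<in> E"
    using symmetric_sum_in_subfield[of E w r B] E w by blast
  also have "(\<Sum>k\<le>r. \<Sum>l\<le>r. w k * w l * B k l)
      = (\<Sum>k\<le>r. \<Sum>l\<le>r. \<Sum>i\<in>I. w k * x i ^ (?q ^ k) * (w l * y i ^ (?q ^ l)))"
    by (simp add: B_def sum_distrib_left mult_ac)
  also have "\<dots> = (\<Sum>k\<le>r. \<Sum>i\<in>I. \<Sum>l\<le>r. w k * x i ^ (?q ^ k) * (w l * y i ^ (?q ^ l)))"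
    by (intro sum.cong refl sum.swap)
  also have "\<dots> = (\<Sum>i\<in>I. \<Sum>k\<le>r. \<Sum>l\<le>r. w k * x i ^ (?q ^ k) * (w l * y i ^ (?q ^ l)))"
    by (rule sum.swap)
  also have "\<dots> = (\<Sum>i\<in>I. poly (additive_poly w r) (x i) * poly (additive_poly w r) (y i))"
    by (simp add: poly_additive_poly sum_product)
  finally show ?thesis .
qed

end

section \<open>The quadratic form and its isometries\<close>

text \<open>The form h_1, with \<open>bil\<close> below as its polar form, over an arbitrary ring:
  both are evaluated at vectors over F_q as well as at the variables and their Frobenius powers.
  Coordinates \<open>l\<close> and \<open>2*m + 2 - l\<close> are partners.\<close>

definition quad :: "nat \<Rightarrow> (nat \<Rightarrow> 'b::comm_ring_1) \<Rightarrow> 'b" where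
  "quad m x = (\<Sum>l = 1..m. x l * x (2*m + 2 - l)) + x (m + 1) ^ 2"

definition bil :: "nat \<Rightarrow> (nat \<Rightarrow> 'b::comm_ring_1) \<Rightarrow> (nat \<Rightarrow> 'b) \<Rightarrow> 'b" where
  "bil m x y = (\<Sum>l = 1..m. x l * y (2*m + 2 - l) + x (2*m + 2 - l) * y l) + 2 * x (m + 1) * y (m + 1)"

lemma partner_in_range: "l \<in> {1..m} \<Longrightarrow> 2*m + 2 - l \<in> {1..2*m + 1}" for l m :: nat
  by auto

lemma quad_cong:
  assumes "\<And>r. r \<in> {1..2*m + 1} \<Longrightarrow> x r = y r"
  shows "quad m x = quad m y"
proof -
  have "x l = y l" "x (2*m + 2 - l) = y (2*m + 2 - l)" if "l \<in> {1..m}" for l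
    using that assms[of l] assms[OF partner_in_range[OF that]] by simp_all
  moreover have "x (m + 1) = y (m + 1)" by (rule assms) simp
  ultimately show ?thesis by (simp add: quad_def)
qed

lemma bil_cong:
  assumes "\<And>r. r \<in> {1..2*m + 1} \<Longrightarrow> x r = x' r" "\<And>r. r \<in> {1..2*m + 1} \<Longrightarrow> y r = y' r"
  shows "bil m x y = bil m x' y'"
proof -
  have "x l = x' l" "x (2*m + 2 - l) = x' (2*m + 2 - l)"
    "y l = y' l" "y (2*m + 2 - l) = y' (2*m + 2 - l)" if "l \<in> {1..m}" for l
    using that assms[of l] assms[OF partner_in_range[OF that]] by simp_all
  moreover have "x (m + 1) = x' (m + 1)" "y (m + 1) = y' (m + 1)" by (rule assms, simp)+
  ultimately show ?thesis by (simp add: bil_def)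
qed

lemma quad_add: "quad m (\<lambda>r. x r + y r) = quad m x + quad m y + bil m x y"
  by (simp add: quad_def bil_def algebra_simps sum.distrib power2_eq_square)

lemma bil_self: "bil m x x = 2 * quad m x"
  by (simp add: quad_def bil_def algebra_simps sum.distrib power2_eq_square sum_distrib_left)

lemma quad_scale: "quad m (\<lambda>r. a * x r) = a ^ 2 * quad m x"
  by (simp add: quad_def algebra_simps power2_eq_square sum_distrib_left)

lemma bil_scale: "bil m x (\<lambda>r. a * y r) = a * bil m x y"
  by (simp add: bil_def algebra_simps sum_distrib_left)

lemma bil_zero_left: "bil m (\<lambda>r. 0) y = 0"
  by (simp add: bil_def)

lemma bil_add_left: "bil m (\<lambda>r. x r + x' r) y = bil m x y + bil m x' y"
  by (simp add: bil_def algebra_simps sum.distrib)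

lemma bil_scale_left: "bil m (\<lambda>r. a * x r) y = a * bil m x y"
  by (simp add: bil_def algebra_simps sum_distrib_left)

lemma bil_sum_left:
  "bil m (\<lambda>r. \<Sum>s\<in>I. c s r * x s) y = (\<Sum>s\<in>I. x s * bil m (c s) y)"
proof (induction I rule: infinite_finite_induct)
  case (insert s I)
  have "bil m (\<lambda>r. c s r * x s) y = x s * bil m (c s) y"
    using bil_scale_left[of m "x s" "c s" y] by (simp add: mult.commute)
  with insert show ?case by (simp add: bil_add_left)
qed (simp_all add: bil_zero_left)

text \<open>The product N x. Entries pass through \<open>\<kappa>\<close>, so a matrix over F_q can
  act on a vector of rational functions; coordinates count from 1, matrix entries from 0.\<close>

definition mat_app :: "('a \<Rightarrow> 'b) \<Rightarrow> 'a mat \<Rightarrow> (nat \<Rightarrow> 'b::comm_ring_1) \<Rightarrow> nat \<Rightarrow> 'b" where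
  "mat_app \<kappa> N x r = (\<Sum>s = 1..dim_col N. \<kappa> (N $$ (r - 1, s - 1)) * x s)"

text \<open>A description of G that does not depend on the parity of q. Invariance is demanded at
  vectors over F_q only; \<open>quad_mat_app\<close> extends it to larger fields.\<close>

definition isometry_group :: "nat \<Rightarrow> 'a::field mat set" where
  "isometry_group m = {N \<in> unitri (2*m + 1). \<forall>v. quad m (mat_app id N v) = quad m v}"

definition unit_fun :: "nat \<Rightarrow> nat \<Rightarrow> 'b::comm_ring_1" where
  "unit_fun s r = (if r = s then 1 else 0)"

lemma mat_app_unit_fun:
  "s \<in> {1..dim_col N} \<Longrightarrow> mat_app id N (unit_fun s) r = N $$ (r - 1, s - 1)"
  by (simp add: mat_app_def unit_fun_def if_distrib[of "\<lambda>a. _ * a"] cong: if_cong)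

lemma quad_unit_fun: "s \<in> {1..2*m + 1} \<Longrightarrow> quad m (unit_fun s) = (if s = m + 1 then 1 else 0)"
  by (auto simp: quad_def unit_fun_def intro!: sum.neutral)

text \<open>Expanding a quadratic form at a linear combination produces only its values at the
  single vectors and the polar form at pairs of them. This holds in every characteristic.\<close>

lemma quad_sum_cong:
  fixes x :: "nat \<Rightarrow> 'b::comm_ring_1"
  assumes "finite I"
    and "\<And>s. s \<in> I \<Longrightarrow> quad m (c s) = quad m (c' s)"
    and "\<And>s t. s \<in> I \<Longrightarrow> t \<in> I \<Longrightarrow> bil m (c s) (c t) = bil m (c' s) (c' t)"
  shows "quad m (\<lambda>r. \<Sum>s\<in>I. c s r * x s) = quad m (\<lambda>r. \<Sum>s\<in>I. c' s r * x s)"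
  using assms
proof (induction I rule: finite_induct)
  case (insert t I)
  have *: "quad m (\<lambda>r. \<Sum>s\<in>insert t I. d s r * x s) = x t ^ 2 * quad m (d t)
      + quad m (\<lambda>r. \<Sum>s\<in>I. d s r * x s) + (\<Sum>s\<in>I. x s * (x t * bil m (d s) (d t)))"
    for d :: "nat \<Rightarrow> nat \<Rightarrow> 'b"
  proof -
    have "quad m (\<lambda>r. \<Sum>s\<in>insert t I. d s r * x s)
        = quad m (\<lambda>r. (\<Sum>s\<in>I. d s r * x s) + x t * d t r)"
      using insert.hyps by (simp add: algebra_simps)
    also have "\<dots> = quad m (\<lambda>r. \<Sum>s\<in>I. d s r * x s) + quad m (\<lambda>r. x t * d t r)
        + bil m (\<lambda>r. \<Sum>s\<in>I. d s r * x s) (\<lambda>r. x t * d t r)"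
      by (rule quad_add)
    finally show ?thesis
      by (simp add: quad_scale bil_sum_left bil_scale)
  qed
  show ?case unfolding * using insert by simp
qed simp

context scalars
begin

lemma scalar_numeral_2: "\<kappa> 2 = 2"
  using scalar_add[of 1 1] by (simp add: scalar_one)

lemma scalar_quad: "\<kappa> (quad m x) = quad m (\<lambda>r. \<kappa> (x r))"
  by (simp add: quad_def scalar_add scalar_sum scalar_mult scalar_power)

lemma scalar_bil: "\<kappa> (bil m x y) = bil m (\<lambda>r. \<kappa> (x r)) (\<lambda>r. \<kappa> (y r))"
  by (simp add: bil_def scalar_add scalar_sum scalar_mult scalar_numeral_2)

text \<open>Testing the hypothesis at unit vectors and at sums of two of them determines
  \<open>quad\<close> and \<open>bil\<close> on the columns of \<open>N\<close>. By
  \<open>quad_sum_cong\<close> these data suffice for coefficients \<open>x\<close> in any extension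
  field.\<close>

lemma quad_mat_app:
  assumes "N \<in> isometry_group m"
  shows "quad m (mat_app \<kappa> N x) = quad m x"
proof -
  let ?n = "2*m + 1"
  have N: "dim_col N = ?n" and iso: "quad m (mat_app id N v) = quad m v" for v
    using assms by (auto simp: isometry_group_def unitri_def)
  define c where "c s r = N $$ (r - 1, s - 1)" for s r
  have c: "mat_app id N (unit_fun s) = c s" if "s \<in> {1..?n}" for s
    using that N by (auto simp: mat_app_unit_fun c_def)
  have q: "quad m (c s) = quad m (unit_fun s)" if "s \<in> {1..?n}" for s
    using iso[of "unit_fun s"] c that by simp
  have b: "bil m (c s) (c t) = bil m (unit_fun s) (unit_fun t)"
    if "s \<in> {1..?n}" "t \<in> {1..?n}" for s t
  proof -
    have "mat_app id N (\<lambda>r. unit_fun s r + unit_fun t r) = (\<lambda>r. c s r + c t r)"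
      using c[OF that(1)] c[OF that(2)]
      by (auto simp: mat_app_def fun_eq_iff algebra_simps sum.distrib)
    then have "quad m (\<lambda>r. c s r + c t r) = quad m (\<lambda>r. unit_fun s r + unit_fun t r)"
      using iso by metis
    then show ?thesis using q that by (simp add: quad_add)
  qed
  have "quad m (mat_app \<kappa> N x) = quad m (\<lambda>r. \<Sum>s = 1..?n. \<kappa> (c s r) * x s)"
    by (simp add: mat_app_def[abs_def] N c_def)
  also have "\<dots> = quad m (\<lambda>r. \<Sum>s = 1..?n. \<kappa> (unit_fun s r) * x s)"
    by (rule quad_sum_cong) (simp_all add: q b flip: scalar_quad scalar_bil)
  also have "\<dots> = quad m x"
  proof (rule quad_cong)
    fix r assume r: "r \<in> {1..?n}"
    have "(\<Sum>s = 1..?n. \<kappa> (unit_fun s r) * x s) = (\<Sum>s = 1..?n. if s = r then x s else 0)"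
      by (intro sum.cong) (auto simp: unit_fun_def scalar_one scalar_zero)
    then show "(\<Sum>s = 1..?n. \<kappa> (unit_fun s r) * x s) = x r" using r by simp
  qed
  finally show ?thesis .
qed

lemma bil_mat_app:
  assumes "N \<in> isometry_group m"
  shows "bil m (mat_app \<kappa> N x) (mat_app \<kappa> N y) = bil m x y"
proof -
  have "mat_app \<kappa> N (\<lambda>r. x r + y r) = (\<lambda>r. mat_app \<kappa> N x r + mat_app \<kappa> N y r)"
    by (auto simp: mat_app_def algebra_simps sum.distrib)
  then have "quad m (\<lambda>r. mat_app \<kappa> N x r + mat_app \<kappa> N y r) = quad m (\<lambda>r. x r + y r)"
    using quad_mat_app[OF assms, of "\<lambda>r. x r + y r"] by simp
  then show ?thesis by (simp add: quad_add quad_mat_app[OF assms])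
qed

lemma mat_app_mult:
  assumes "N \<in> carrier_mat n n" "M \<in> carrier_mat n n" "r \<in> {1..n}"
  shows "mat_app \<kappa> (N * M) x r = mat_app \<kappa> N (mat_app \<kappa> M x) r"
proof -
  have "(N * M) $$ (r - 1, t - 1) = (\<Sum>s = 1..n. N $$ (r - 1, s - 1) * M $$ (s - 1, t - 1))"
    if "t \<in> {1..n}" for t
  proof -
    have "(N * M) $$ (r - 1, t - 1) = (\<Sum>s<n. N $$ (r - 1, s) * M $$ (s, t - 1))"
      using assms that by (auto simp: scalar_prod_def atLeast0LessThan)
    also have "\<dots> = (\<Sum>s = 1..n. N $$ (r - 1, s - 1) * M $$ (s - 1, t - 1))"
      by (rule sum.reindex_bij_witness[of _ "\<lambda>s. s - 1" Suc]) auto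
    finally show ?thesis .
  qed
  then have "mat_app \<kappa> (N * M) x r
      = (\<Sum>t = 1..n. \<Sum>s = 1..n. \<kappa> (N $$ (r - 1, s - 1)) * (\<kappa> (M $$ (s - 1, t - 1)) * x t))"
    using assms by (simp add: mat_app_def scalar_sum scalar_mult sum_distrib_right mult.assoc)
  also have "\<dots> = mat_app \<kappa> N (mat_app \<kappa> M x) r"
    using assms by (subst sum.swap) (simp add: mat_app_def sum_distrib_left)
  finally show ?thesis .
qed

lemma mat_app_one:
  assumes "r \<in> {1..n}"
  shows "mat_app \<kappa> (1\<^sub>m n) x r = x r"
proof -
  have "mat_app \<kappa> (1\<^sub>m n) x r = (\<Sum>s = 1..n. if s = r then x s else 0)"
    unfolding mat_app_def using assms
    by (intro sum.cong) (auto simp: scalar_zero scalar_one)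
  then show ?thesis using assms by simp
qed

text \<open>The entries of \<open>N\<close> come from F_q and are fixed by Frobenius. Hence the
  twisted variables transform by the same matrix as the variables, which is the source of the
  invariance of the h_k.\<close>

lemma mat_app_frobenius:
  "mat_app \<kappa> N x r ^ (CARD('a) ^ k) = mat_app \<kappa> N (\<lambda>s. x s ^ (CARD('a) ^ k)) r"
  by (simp add: mat_app_def frobenius_power_sum power_mult_distrib frobenius_power_scalar)

lemma mat_app_unitri:
  assumes "N \<in> unitri n" "r \<in> {1..n}"
  shows "mat_app \<kappa> N x r = x r + (\<Sum>s = 1..<r. \<kappa> (N $$ (r - 1, s - 1)) * x s)"
proof -
  have "mat_app \<kappa> N x r = (\<Sum>s = 1..n. \<kappa> (N $$ (r - 1, s - 1)) * x s)"
    using assms by (auto simp: mat_app_def unitri_def)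
  also have "\<dots> = (\<Sum>s = 1..r. \<kappa> (N $$ (r - 1, s - 1)) * x s)"
    using assms by (intro sum.mono_neutral_right) (auto simp: unitri_def scalar_zero)
  also have "\<dots> = (\<Sum>s\<in>insert r {1..<r}. \<kappa> (N $$ (r - 1, s - 1)) * x s)"
    using assms by (intro sum.cong) auto
  also have "\<dots> = \<kappa> (N $$ (r - 1, r - 1)) * x r + (\<Sum>s = 1..<r. \<kappa> (N $$ (r - 1, s - 1)) * x s)"
    by simp
  also have "N $$ (r - 1, r - 1) = 1" using assms by (auto simp: unitri_def)
  finally show ?thesis by (simp add: scalar_one)
qed

end

section \<open>Products and inverses of unitriangular isometries\<close>

lemma scalars_id: "scalars (id :: 'a::{field, finite} \<Rightarrow> 'a)"
  by unfold_locales auto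

lemma unitri_mult:
  assumes "N \<in> unitri n" "M \<in> unitri n"
  shows "N * M \<in> unitri n"
proof -
  have dims: "N \<in> carrier_mat n n" "M \<in> carrier_mat n n" using assms by (auto simp: unitri_def)
  have entry: "(N * M) $$ (i, j) = (\<Sum>k<n. N $$ (i, k) * M $$ (k, j))" if "i < n" "j < n" for i j
    using dims that by (auto simp: scalar_prod_def atLeast0LessThan)
  have zero: "(N * M) $$ (i, j) = 0" if "i < j" "j < n" for i j
  proof -
    have "N $$ (i, k) * M $$ (k, j) = 0" if "k < n" for k
      using assms that \<open>i < j\<close> \<open>j < n\<close> by (cases "i < k") (auto simp: unitri_def)
    then show ?thesis using that by (subst entry) (auto intro!: sum.neutral)
  qed
  have one: "(N * M) $$ (i, i) = 1" if "i < n" for i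
  proof -
    have "(N * M) $$ (i, i) = (\<Sum>k<n. if k = i then 1 else 0)"
      unfolding entry[OF that that]
    proof (intro sum.cong refl)
      fix k assume "k \<in> {..<n}"
      then show "N $$ (i, k) * M $$ (k, i) = (if k = i then 1 else 0)"
        using assms that by (cases k i rule: linorder_cases) (auto simp: unitri_def)
    qed
    then show ?thesis using that by simp
  qed
  show ?thesis using dims zero one by (auto simp: unitri_def)
qed

lemma isometry_mult:
  assumes "N \<in> isometry_group m" "M \<in> (isometry_group m :: 'a::{field, finite} mat set)"
  shows "N * M \<in> isometry_group m"
proof -
  have dims: "N \<in> carrier_mat (2*m + 1) (2*m + 1)" "M \<in> carrier_mat (2*m + 1) (2*m + 1)"
    using assms by (auto simp: isometry_group_def unitri_def)
  have "quad m (mat_app id (N * M) v) = quad m v" for v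
  proof -
    have "quad m (mat_app id (N * M) v) = quad m (mat_app id N (mat_app id M v))"
      by (rule quad_cong) (rule scalars.mat_app_mult[OF scalars_id dims])
    then show ?thesis using assms by (simp add: isometry_group_def)
  qed
  then show ?thesis using assms unitri_mult by (auto simp: isometry_group_def)
qed

text \<open>The determinant is the product of the diagonal entries, hence 1, so an inverse exists;
  its shape is then read off row by row.\<close>

lemma unitri_inverse:
  fixes N :: "'a::field mat"
  assumes N: "N \<in> unitri n"
  obtains N' where "N' \<in> unitri n" "N * N' = 1\<^sub>m n" "N' * N = 1\<^sub>m n"
proof -
  have dim: "N \<in> carrier_mat n n" using N by (simp add: unitri_def)
  have "det N = prod_list (diag_mat N)"
    using N by (intro det_lower_triangular[OF _ dim]) (auto simp: unitri_def)
  also have "\<dots> = 1"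
    using N dim by (auto simp: unitri_def prod_list_diag_prod intro!: prod.neutral)
  finally have "N \<in> Units (ring_mat TYPE('a) n ())"
    by (intro det_non_zero_imp_unit[OF dim]) simp
  then obtain N' where N': "N' \<in> carrier_mat n n" "N * N' = 1\<^sub>m n" "N' * N = 1\<^sub>m n"
    by (auto simp: Units_def ring_mat_def)
  \<comment> \<open>Forward substitution: the rows of \<open>N'\<close> above row \<open>i\<close>
    already vanish in the columns \<open>j \<ge> i\<close>, and \<open>N\<close> vanishes right of
    its diagonal, so only the summand k = i of the product survives.\<close>
  have "\<forall>j<n. i \<le> j \<longrightarrow> N' $$ (i, j) = (if i = j then 1 else 0)" if "i < n" for i
    using that
  proof (induction i rule: less_induct)
    case (less i)
    show ?case
    proof (intro allI impI)
      fix j assume j: "j < n" "i \<le> j"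
      have "(if i = j then 1 else 0) = (N * N') $$ (i, j)"
        using less.prems j by (simp add: N'(2))
      also have "\<dots> = (\<Sum>k<n. N $$ (i, k) * N' $$ (k, j))"
        using dim N'(1) less.prems j by (auto simp: scalar_prod_def atLeast0LessThan)
      also have "\<dots> = (\<Sum>k<n. if k = i then N' $$ (k, j) else 0)"
      proof (intro sum.cong refl)
        fix k assume "k \<in> {..<n}"
        then show "N $$ (i, k) * N' $$ (k, j) = (if k = i then N' $$ (k, j) else 0)"
          using N less j by (cases k i rule: linorder_cases) (auto simp: unitri_def)
      qed
      also have "\<dots> = N' $$ (i, j)" using less.prems by simp
      finally show "N' $$ (i, j) = (if i = j then 1 else 0)" by simp
    qed
  qed
  then have "N' \<in> unitri n" using N'(1) by (auto simp: unitri_def)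
  then show ?thesis using that N' by blast
qed

lemma isometry_inverse:
  assumes "N \<in> (isometry_group m :: 'a::{field, finite} mat set)"
  obtains N' where "N' \<in> isometry_group m" "N * N' = 1\<^sub>m (2*m + 1)" "N' * N = 1\<^sub>m (2*m + 1)"
proof -
  let ?n = "2*m + 1"
  have "N \<in> unitri ?n" using assms by (simp add: isometry_group_def)
  then obtain N' where N': "N' \<in> unitri ?n" "N * N' = 1\<^sub>m ?n" "N' * N = 1\<^sub>m ?n"
    by (rule unitri_inverse)
  have dims: "N \<in> carrier_mat ?n ?n" "N' \<in> carrier_mat ?n ?n"
    using N' assms by (auto simp: isometry_group_def unitri_def)
  have "quad m (mat_app id N' v) = quad m v" for v
  proof -
    have "quad m v = quad m (mat_app id (N * N') v)"
      unfolding N'(2)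
      by (rule quad_cong) (rule scalars.mat_app_one[OF scalars_id, symmetric])
    also have "\<dots> = quad m (mat_app id N (mat_app id N' v))"
      by (rule quad_cong) (rule scalars.mat_app_mult[OF scalars_id dims])
    also have "\<dots> = quad m (mat_app id N' v)"
      using assms by (simp add: isometry_group_def)
    finally show ?thesis by simp
  qed
  then show ?thesis using that N' by (auto simp: isometry_group_def)
qed

text \<open>
  An Eichler transformation: it adds the linear form \<open>u\<close> to \<open>x\<^sub>i\<close> and corrects the partners of the
  variables occurring in \<open>u\<close>.
\<close>

lemma isometry_exists:
  fixes c :: "nat \<Rightarrow> 'a::{field, finite}"
  assumes i: "i \<in> {1..2*m + 1}"
    and c: "\<And>l. c l \<noteq> 0 \<Longrightarrow> 1 \<le> l \<and> l \<le> m \<and> l < i"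
  obtains N p where "N \<in> isometry_group m"
    and "\<And>(\<kappa> :: 'a \<Rightarrow> 'b::field) x r. scalars \<kappa> \<Longrightarrow> r \<in> {1..2*m + 1} \<Longrightarrow>
      mat_app \<kappa> N x r = x r + (if r = i then \<Sum>l = 1..m. \<kappa> (c l) * x l else 0)
        - \<kappa> (c (2*m + 2 - r)) * p \<kappa> x"
proof -
  let ?n = "2*m + 1"
  \<comment> \<open>\<open>P\<close> holds the coefficients of the form p that balances the change
    of \<open>quad\<close>. Adding u to x_i contributes u times the partner of x_i, or u (2 x_{m+1}
    + u) if i = m + 1; subtracting c_l p from the partner of each x_l contributes -u p.\<close>
  define P where "P s = (if i = m + 1 then (if s = m + 1 then 2 else 0) + c s
    else if s = 2*m + 2 - i then 1 else 0)" for s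
  define N where "N = mat ?n ?n (\<lambda>(r, s). (if r = s then 1 else 0)
    + (if r + 1 = i then c (s + 1) else 0) - c (2*m + 1 - r) * P (s + 1))"
  have c0: "c l = 0" if "\<not> (1 \<le> l \<and> l \<le> m \<and> l < i)" for l using c that by blast
  have c_partner: "c (Suc (Suc (2*m)) - l) = 0" if "l \<le> Suc m" for l
  proof -
    have "\<not> Suc (Suc (2*m)) - l \<le> m" using that by linarith
    then show ?thesis using c by blast
  qed
  have app: "mat_app \<kappa> N x r = x r + (if r = i then \<Sum>l = 1..m. \<kappa> (c l) * x l else 0)
        - \<kappa> (c (2*m + 2 - r)) * (\<Sum>s = 1..?n. \<kappa> (P s) * x s)"
    if "scalars \<kappa>" and r: "r \<in> {1..?n}" for \<kappa> :: "'a \<Rightarrow> 'c::field" and x r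
  proof -
    interpret scalars \<kappa> by fact
    have "mat_app \<kappa> N x r = (\<Sum>s = 1..?n. (if s = r then x s else 0)
        + (if r = i then \<kappa> (c s) * x s else 0) - \<kappa> (c (2*m + 2 - r)) * (\<kappa> (P s) * x s))"
      unfolding mat_app_def using r
      by (intro sum.cong)
        (auto simp: N_def scalar_add scalar_diff scalar_mult scalar_one scalar_zero algebra_simps)
    also have "\<dots> = (\<Sum>s = 1..?n. if s = r then x s else 0)
        + (\<Sum>s = 1..?n. if r = i then \<kappa> (c s) * x s else 0)
        - \<kappa> (c (2*m + 2 - r)) * (\<Sum>s = 1..?n. \<kappa> (P s) * x s)"
      by (simp only: sum.distrib sum_subtractf sum_distrib_left)
    also have "(\<Sum>s = 1..?n. if s = r then x s else 0) = x r"
      using r by (subst sum.delta) auto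
    also have "(\<Sum>s = 1..?n. if r = i then \<kappa> (c s) * x s else 0)
        = (if r = i then \<Sum>s = 1..?n. \<kappa> (c s) * x s else 0)" by simp
    also have "(\<Sum>s = 1..?n. \<kappa> (c s) * x s) = (\<Sum>l = 1..m. \<kappa> (c l) * x l)"
      by (rule sum.mono_neutral_right) (auto simp: c0 scalar_zero)
    finally show ?thesis .
  qed
  \<comment> \<open>Lower triangularity: the partner of x_l has index 2m + 2 - l, whereas p involves
    only the index 2m + 2 - i, or indices up to m + 1 if i = m + 1. These are smaller because l < i
    and l \<le> m.\<close>
  have cP: "c (2*m + 1 - r) * P (s + 1) = 0" if "r \<le> s" "s < ?n" for r s
  proof -
    have "P (s + 1) = 0" if "c (2*m + 1 - r) \<noteq> 0"
      using c[OF that] i \<open>r \<le> s\<close> \<open>s < ?n\<close> by (auto simp: P_def c0)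
    then show ?thesis by (metis mult_zero_left mult_zero_right)
  qed
  have ci: "(if r + 1 = i then c (s + 1) else 0) = 0" if "r \<le> s" for r s
    using that by (auto intro: c0)
  have "N $$ (r, s) = (if r = s then 1 else 0)" if "r \<le> s" "s < ?n" for r s
  proof -
    have "N $$ (r, s) = (if r = s then 1 else 0)
      + (if r + 1 = i then c (s + 1) else 0) - c (2*m + 1 - r) * P (s + 1)"
      using that by (simp add: N_def)
    then show ?thesis unfolding cP[OF that] ci[OF that(1)] by simp
  qed
  then have unitri: "N \<in> unitri ?n" by (auto simp: unitri_def N_def)
  have "quad m (mat_app id N v) = quad m v" for v
  proof -
    define u where "u = (\<Sum>l = 1..m. c l * v l)"
    define p where "p = (\<Sum>s = 1..?n. P s * v s)"
    define w where "w r = v r + (if r = i then u else 0) - c (2*m + 2 - r) * p" for r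
    have "quad m (mat_app id N v) = quad m w"
      by (rule quad_cong) (simp add: app[OF scalars_id] w_def u_def p_def)
    moreover have "quad m w = (\<Sum>l = 1..m. (v l + (if l = i then u else 0)) *
        (v (2*m + 2 - l) + (if 2*m + 2 - l = i then u else 0) - c l * p))
        + (v (m + 1) + (if i = m + 1 then u else 0)) ^ 2" (is "_ = ?s + _")
      unfolding quad_def
      by (intro arg_cong2[where f = "(+)"] sum.cong refl arg_cong2[where f = "(*)"]
          arg_cong[where f = "\<lambda>x. x ^ 2"]) (auto simp: w_def c0 c_partner)
    moreover have "?s + (v (m + 1) + (if i = m + 1 then u else 0)) ^ 2 = quad m v"
    proof (cases i "m + 1" rule: linorder_cases)
      case less
      have "p = (\<Sum>s = 1..?n. if s = 2*m + 2 - i then v s else 0)"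
        unfolding p_def using less by (intro sum.cong) (auto simp: P_def)
      also have "\<dots> = v (2*m + 2 - i)"
        using less i by (subst sum.delta) auto
      finally have p: "p = v (2*m + 2 - i)" .
      have "?s = (\<Sum>l = 1..m. v l * v (2*m + 2 - l) - c l * v l * p
          + (if l = i then u * v (2*m + 2 - i) else 0))"
        using less by (intro sum.cong) (auto simp: c0 algebra_simps)
      also have "\<dots> = (\<Sum>l = 1..m. v l * v (2*m + 2 - l)) - u * p + u * v (2*m + 2 - i)"
        using less i by (simp add: sum.distrib sum_subtractf u_def sum_distrib_right)
      finally show ?thesis using less by (simp add: quad_def p)
    next
      case equal
      have "p = (\<Sum>s = 1..?n. (if s = m + 1 then 2 * v s else 0) + c s * v s)"
        unfolding p_def by (intro sum.cong) (auto simp: P_def equal algebra_simps)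
      also have "\<dots> = 2 * v (m + 1) + (\<Sum>s = 1..?n. c s * v s)"
        by (simp add: sum.distrib)
      also have "(\<Sum>s = 1..?n. c s * v s) = u"
        unfolding u_def by (rule sum.mono_neutral_right) (auto simp: c0)
      finally have p: "p = 2 * v (m + 1) + u" .
      have "?s = (\<Sum>l = 1..m. v l * v (2*m + 2 - l) - c l * v l * p)"
        using equal by (intro sum.cong) (auto simp: algebra_simps)
      also have "\<dots> = (\<Sum>l = 1..m. v l * v (2*m + 2 - l)) - u * p"
        by (simp add: sum_subtractf u_def sum_distrib_right)
      finally show ?thesis
        using equal by (simp add: quad_def p power2_eq_square algebra_simps)
    next
      case greater
      define j where "j = 2*m + 2 - i"
      have j: "j \<in> {1..m}" using greater i by (auto simp: j_def)
      have "p = (\<Sum>s = 1..?n. if s = j then v s else 0)"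
        unfolding p_def using greater by (intro sum.cong) (auto simp: P_def j_def)
      also have "\<dots> = v j" using j by (subst sum.delta) auto
      finally have p: "p = v j" .
      have "?s = (\<Sum>l = 1..m. v l * v (2*m + 2 - l) - c l * v l * p
          + (if l = j then v l * u else 0))"
        using greater i by (intro sum.cong) (auto simp: j_def algebra_simps)
      also have "\<dots> = (\<Sum>l = 1..m. v l * v (2*m + 2 - l)) - u * p + v j * u"
        using j by (simp add: sum.distrib sum_subtractf u_def sum_distrib_right)
      finally show ?thesis using greater by (simp add: quad_def p)
    qed
    ultimately show ?thesis by simp
  qed
  then have "N \<in> isometry_group m" using unitri by (simp add: isometry_group_def)
  then show ?thesis using that[of N "\<lambda>\<kappa> x. \<Sum>s = 1..?n. \<kappa> (P s) * x s"] app by blast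
qed

section \<open>The Sylow subgroup as an isometry group\<close>

text \<open>Groups the matrix indices, which start at 0, into partner pairs and the middle index, to
  match the shape of \<open>bil\<close>.\<close>

lemma sum_pairs:
  fixes F :: "nat \<Rightarrow> 'b::comm_monoid_add"
  shows "(\<Sum>i<2*m + 1. F i) = (\<Sum>l = 1..m. F (l - 1) + F (2*m + 1 - l)) + F m"
proof -
  have "{..<2*m + 1} = ((\<lambda>l. l - 1) ` {1..m} \<union> (\<lambda>l. 2*m + 1 - l) ` {1..m}) \<union> {m}"
  proof -
    have "i \<in> (\<lambda>l. l - 1) ` {1..m} \<union> (\<lambda>l. 2*m + 1 - l) ` {1..m} \<union> {m}" if "i < 2*m + 1" for i
    proof (cases i m rule: linorder_cases)
      case less
      then have "i \<in> (\<lambda>l. l - 1) ` {1..m}" by (intro image_eqI[of _ _ "i + 1"]) auto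
      then show ?thesis by blast
    next
      case greater
      then have "i \<in> (\<lambda>l. 2*m + 1 - l) ` {1..m}"
        using that by (intro image_eqI[of _ _ "2*m + 1 - i"]) auto
      then show ?thesis by blast
    qed simp
    then show ?thesis by auto
  qed
  also have "sum F \<dots> = sum F ((\<lambda>l. l - 1) ` {1..m}) + sum F ((\<lambda>l. 2*m + 1 - l) ` {1..m}) + F m"
  proof (subst sum.union_disjoint)
    show "((\<lambda>l. l - 1) ` {1..m} \<union> (\<lambda>l. 2*m + 1 - l) ` {1..m}) \<inter> {m} = {}" by auto
    show "sum F ((\<lambda>l. l - 1) ` {1..m} \<union> (\<lambda>l. 2*m + 1 - l) ` {1..m}) + sum F {m} =
      sum F ((\<lambda>l. l - 1) ` {1..m}) + sum F ((\<lambda>l. 2*m + 1 - l) ` {1..m}) + F m"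
      by (subst sum.union_disjoint) auto
  qed auto
  also have "sum F ((\<lambda>l. l - 1) ` {1..m}) = (\<Sum>l = 1..m. F (l - 1))"
    by (subst sum.reindex) (auto simp: inj_on_def)
  also have "sum F ((\<lambda>l. 2*m + 1 - l) ` {1..m}) = (\<Sum>l = 1..m. F (2*m + 1 - l))"
    by (subst sum.reindex) (auto simp: inj_on_def)
  finally show ?thesis by (simp add: sum.distrib)
qed

section \<open>Entries of block matrices and Gram matrices\<close>

lemma append_cols_carrier:
  "A \<in> carrier_mat k a \<Longrightarrow> B \<in> carrier_mat k b \<Longrightarrow> append_cols A B \<in> carrier_mat k (a + b)"
  unfolding append_cols_def by auto

lemma append_cols_index:
  assumes "A \<in> carrier_mat k a" "B \<in> carrier_mat k b" "i < k" "j < a + b"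
  shows "append_cols A B $$ (i, j) = (if j < a then A $$ (i, j) else B $$ (i, j - a))"
  using assms unfolding append_cols_def by auto

lemma append_rows_index:
  assumes "A \<in> carrier_mat a n" "B \<in> carrier_mat b n" "i < a + b" "j < n"
  shows "(A @\<^sub>r B) $$ (i, j) = (if i < a then A $$ (i, j) else B $$ (i - a, j))"
  using assms unfolding append_rows_def by auto

lemma three_block_mat_carrier:
  assumes "A11 \<in> carrier_mat m m" "A12 \<in> carrier_mat m 1" "A13 \<in> carrier_mat m m"
    "A21 \<in> carrier_mat 1 m" "A22 \<in> carrier_mat 1 1" "A23 \<in> carrier_mat 1 m"
    "A31 \<in> carrier_mat m m" "A32 \<in> carrier_mat m 1" "A33 \<in> carrier_mat m m"
  shows "three_block_mat A11 A12 A13 A21 A22 A23 A31 A32 A33 \<in> carrier_mat (2*m + 1) (2*m + 1)"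
proof -
  have "three_block_mat A11 A12 A13 A21 A22 A23 A31 A32 A33
      \<in> carrier_mat (m + (1 + m)) (m + (1 + m))"
    unfolding three_block_mat_def
    by (intro carrier_append_rows append_cols_carrier assms)
  then show ?thesis by (simp add: mult_2)
qed

lemma three_block_mat_index:
  assumes "A11 \<in> carrier_mat m m" "A12 \<in> carrier_mat m 1" "A13 \<in> carrier_mat m m"
    "A21 \<in> carrier_mat 1 m" "A22 \<in> carrier_mat 1 1" "A23 \<in> carrier_mat 1 m"
    "A31 \<in> carrier_mat m m" "A32 \<in> carrier_mat m 1" "A33 \<in> carrier_mat m m"
    and "i < 2*m + 1" "j < 2*m + 1"
  shows "three_block_mat A11 A12 A13 A21 A22 A23 A31 A32 A33 $$ (i, j) =
    (if i < m then if j < m then A11 $$ (i, j) else if j = m then A12 $$ (i, 0) else A13 $$ (i, j - m - 1)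
     else if i = m then if j < m then A21 $$ (0, j) else if j = m then A22 $$ (0, 0) else A23 $$ (0, j - m - 1)
     else if j < m then A31 $$ (i - m - 1, j) else if j = m then A32 $$ (i - m - 1, 0)
       else A33 $$ (i - m - 1, j - m - 1))"
proof -
  note cols = append_cols_carrier[OF _ append_cols_carrier]
  have cols_index: "append_cols A (append_cols B C) $$ (i, j) = (if j < m then A $$ (i, j)
      else if j = m then B $$ (i, 0) else C $$ (i, j - m - 1))"
    if "A \<in> carrier_mat k m" "B \<in> carrier_mat k 1" "C \<in> carrier_mat k m" "i < k" for A B C :: "'a mat" and k i
    using that assms(11)
    by (auto simp: append_cols_index[OF _ append_cols_carrier] append_cols_index)
  have ij: "i < m + (1 + m)" "j < m + (1 + m)" using assms(10,11) by auto
  show ?thesis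
    unfolding three_block_mat_def
      append_rows_index[OF cols[OF assms(1-3)]
        carrier_append_rows[OF cols[OF assms(4-6)] cols[OF assms(7-9)]] ij]
    using append_rows_index[OF cols[OF assms(4-6)] cols[OF assms(7-9)], of "i - m" j] ij
    by (auto simp: cols_index[OF assms(1-3)] cols_index[OF assms(4-6)] cols_index[OF assms(7-9)])
qed

lemma Y_mat_carrier: "Y_mat m c \<in> carrier_mat (2*m + 1) (2*m + 1)"
  unfolding Y_mat_def by (rule three_block_mat_carrier) (auto simp: antidiag_def)

lemma Y_mat_index:
  assumes "i < 2*m + 1" "j < 2*m + 1"
  shows "Y_mat m c $$ (i, j) = (if i + j = 2*m then if i = m then c else 1 else 0)"
  unfolding Y_mat_def
  by (subst three_block_mat_index[OF _ _ _ _ _ _ _ _ _ assms])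
    (use assms in \<open>simp_all add: antidiag_def, linarith\<close>)

text \<open>Y is the matrix of the polar form of h_1, its middle entry 2 coming from the square of
  x_{m+1}; so N^T Y N is the Gram matrix of the columns of N.\<close>

lemma gram_index:
  assumes N: "N \<in> carrier_mat (2*m + 1) (2*m + 1)" and ab: "a < 2*m + 1" "b < 2*m + 1"
  shows "(transpose_mat N * Y_mat m 2 * N) $$ (a, b)
    = bil m (\<lambda>r. N $$ (r - 1, a)) (\<lambda>r. N $$ (r - 1, b))"
proof -
  let ?n = "2*m + 1"
  have row: "(\<Sum>j<?n. Y_mat m 2 $$ (i, j) * N $$ (j, b)) = (if i = m then 2 else 1) * N $$ (2*m - i, b)"
    if "i < ?n" for i
  proof -
    have "(\<Sum>j<?n. Y_mat m 2 $$ (i, j) * N $$ (j, b))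
        = (\<Sum>j<?n. if j = 2*m - i then (if i = m then 2 else 1) * N $$ (j, b) else 0)"
      using that by (intro sum.cong) (auto simp: Y_mat_index)
    then show ?thesis by (simp add: sum.delta)
  qed
  have "(transpose_mat N * Y_mat m 2 * N) $$ (a, b) = (transpose_mat N * (Y_mat m 2 * N)) $$ (a, b)"
    using N Y_mat_carrier[of m "2 :: 'a"] by (metis assoc_mult_mat transpose_carrier_mat)
  also have "\<dots> = (\<Sum>i<?n. N $$ (i, a) * (\<Sum>j<?n. Y_mat m 2 $$ (i, j) * N $$ (j, b)))"
    using N Y_mat_carrier[of m "2 :: 'a"] ab by (simp add: scalar_prod_def atLeast0LessThan)
  also have "\<dots> = (\<Sum>i<?n. N $$ (i, a) * ((if i = m then 2 else 1) * N $$ (2*m - i, b)))"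
    by (rule sum.cong) (simp_all only: row lessThan_iff)
  also have "\<dots> = (\<Sum>l = 1..m. N $$ (l - 1, a) * N $$ (2*m + 1 - l, b)
      + N $$ (2*m + 1 - l, a) * N $$ (l - 1, b)) + 2 * N $$ (m, a) * N $$ (m, b)"
    unfolding sum_pairs
  proof (intro arg_cong2[where f = "(+)"] sum.cong refl, goal_cases)
    case (1 l)
    then have "l - 1 \<noteq> m" "2*m - (l - 1) = 2*m + 1 - l" by auto
    then show ?case by (simp only: if_False mult_1)
  next
    case (2 l)
    then have "2*m + 1 - l \<noteq> m" "2*m - (2*m + 1 - l) = l - 1" by auto
    then show ?case by (simp only: if_False mult_1)
  next
    case 3
    have "2*m - m = m" by simp
    then show ?case by (simp add: mult_ac)
  qed
  finally show ?thesis by (simp add: bil_def)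
qed

lemma gram_eq_iff:
  assumes N: "N \<in> carrier_mat (2*m + 1) (2*m + 1)"
  shows "transpose_mat N * Y_mat m 2 * N = Y_mat m 2 \<longleftrightarrow>
    (\<forall>s\<in>{1..2*m + 1}. \<forall>t\<in>{1..2*m + 1}.
      bil m (\<lambda>r. N $$ (r - 1, s - 1)) (\<lambda>r. N $$ (r - 1, t - 1)) = bil m (unit_fun s) (unit_fun t))"
proof -
  let ?n = "2*m + 1"
  \<comment> \<open>The entries of Y itself are obtained from \<open>gram_index\<close> at the
    identity matrix.\<close>
  have one: "(transpose_mat (1\<^sub>m ?n) * Y_mat m 2 * 1\<^sub>m ?n :: 'a mat) = Y_mat m 2"
    using Y_mat_carrier[of m "2 :: 'a"] by simp
  have Y: "Y_mat m (2 :: 'a) $$ (a, b) = bil m (unit_fun (a + 1)) (unit_fun (b + 1))"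
    if "a < ?n" "b < ?n" for a b
  proof -
    have "Y_mat m (2 :: 'a) $$ (a, b) = bil m (\<lambda>r. 1\<^sub>m ?n $$ (r - 1, a)) (\<lambda>r. 1\<^sub>m ?n $$ (r - 1, b))"
    proof -
      have "(transpose_mat (1\<^sub>m ?n) * Y_mat m 2 * 1\<^sub>m ?n :: 'a mat) $$ (a, b)
          = bil m (\<lambda>r. 1\<^sub>m ?n $$ (r - 1, a)) (\<lambda>r. 1\<^sub>m ?n $$ (r - 1, b))"
        by (rule gram_index) (use that in auto)
      then show ?thesis by (simp only: one)
    qed
    also have "\<dots> = bil m (unit_fun (a + 1)) (unit_fun (b + 1))"
      by (rule bil_cong) (use that in \<open>auto simp: unit_fun_def\<close>)
    finally show ?thesis .
  qed
  have "transpose_mat N * Y_mat m 2 * N = Y_mat m 2 \<longleftrightarrow>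
    (\<forall>a<?n. \<forall>b<?n. bil m (\<lambda>r. N $$ (r - 1, a)) (\<lambda>r. N $$ (r - 1, b))
      = bil m (unit_fun (a + 1)) (unit_fun (b + 1)))" (is "_ \<longleftrightarrow> ?R")
  proof
    assume "transpose_mat N * Y_mat m 2 * N = Y_mat m 2"
    then show ?R using gram_index[OF N] Y by metis
  next
    assume R: ?R
    show "transpose_mat N * Y_mat m 2 * N = Y_mat m 2"
    proof (rule eq_matI)
      show "dim_row (transpose_mat N * Y_mat m 2 * N) = dim_row (Y_mat m (2 :: 'a))"
        "dim_col (transpose_mat N * Y_mat m 2 * N) = dim_col (Y_mat m (2 :: 'a))"
        using N Y_mat_carrier[of m "2 :: 'a"] by auto
      fix a b assume "a < dim_row (Y_mat m (2 :: 'a))" "b < dim_col (Y_mat m (2 :: 'a))"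
      then have ab: "a < ?n" "b < ?n" using Y_mat_carrier[of m "2 :: 'a"] by auto
      then show "(transpose_mat N * Y_mat m 2 * N) $$ (a, b) = Y_mat m 2 $$ (a, b)"
        using R by (simp only: gram_index[OF N ab] Y[OF ab])
    qed
  qed
  also have "\<dots> \<longleftrightarrow> (\<forall>s\<in>{1..?n}. \<forall>t\<in>{1..?n}.
      bil m (\<lambda>r. N $$ (r - 1, s - 1)) (\<lambda>r. N $$ (r - 1, t - 1)) = bil m (unit_fun s) (unit_fun t))"
    (is "?R \<longleftrightarrow> ?S")
  proof
    assume R: ?R
    show ?S
    proof (intro ballI)
      fix s t assume "s \<in> {1..?n}" "t \<in> {1..?n}"
      then have "s - 1 < ?n" "t - 1 < ?n" "s - 1 + 1 = s" "t - 1 + 1 = t" by auto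
      then show "bil m (\<lambda>r. N $$ (r - 1, s - 1)) (\<lambda>r. N $$ (r - 1, t - 1))
        = bil m (unit_fun s) (unit_fun t)"
        using R by metis
    qed
  next
    assume S: ?S
    show ?R
    proof (intro allI impI)
      fix a b assume "a < ?n" "b < ?n"
      then show "bil m (\<lambda>r. N $$ (r - 1, a)) (\<lambda>r. N $$ (r - 1, b))
        = bil m (unit_fun (a + 1)) (unit_fun (b + 1))"
        using S[rule_format, of "a + 1" "b + 1"] by simp
    qed
  qed
  finally show ?thesis .
qed

text \<open>A quadratic form is determined by its polar form together with its values on a basis.
  The Gram condition settles the former, the conditions on the columns the latter.\<close>

lemma isometry_group_iff:
  fixes N :: "'a::{field, finite} mat"
  shows "N \<in> isometry_group m \<longleftrightarrow> N \<in> unitri (2*m + 1) \<and>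
    transpose_mat N * Y_mat m 2 * N = Y_mat m 2 \<and>
    (\<forall>s\<in>{1..2*m + 1}. quad m (\<lambda>r. N $$ (r - 1, s - 1)) = quad m (unit_fun s))"
proof (cases "N \<in> unitri (2*m + 1)")
  case True
  let ?n = "2*m + 1"
  have N: "N \<in> carrier_mat ?n ?n" using True by (simp add: unitri_def)
  have col: "mat_app id N (unit_fun s) = (\<lambda>r. N $$ (r - 1, s - 1))" if "s \<in> {1..?n}" for s
    using that N by (auto simp: fun_eq_iff mat_app_unit_fun)
  show ?thesis
  proof
    assume iso: "N \<in> isometry_group m"
    have "quad m (\<lambda>r. N $$ (r - 1, s - 1)) = quad m (unit_fun s)" if "s \<in> {1..?n}" for s
      using scalars.quad_mat_app[OF scalars_id iso, of "unit_fun s"] by (simp only: col[OF that])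
    moreover have "bil m (\<lambda>r. N $$ (r - 1, s - 1)) (\<lambda>r. N $$ (r - 1, t - 1))
        = bil m (unit_fun s) (unit_fun t)" if "s \<in> {1..?n}" "t \<in> {1..?n}" for s t
      using scalars.bil_mat_app[OF scalars_id iso, of "unit_fun s" "unit_fun t"]
      by (simp only: col[OF that(1)] col[OF that(2)])
    ultimately show "N \<in> unitri ?n \<and> transpose_mat N * Y_mat m 2 * N = Y_mat m 2 \<and>
      (\<forall>s\<in>{1..?n}. quad m (\<lambda>r. N $$ (r - 1, s - 1)) = quad m (unit_fun s))"
      using True gram_eq_iff[OF N] by blast
  next
    assume R: "N \<in> unitri ?n \<and> transpose_mat N * Y_mat m 2 * N = Y_mat m 2 \<and>
      (\<forall>s\<in>{1..?n}. quad m (\<lambda>r. N $$ (r - 1, s - 1)) = quad m (unit_fun s))"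
    have "quad m (mat_app id N v) = quad m v" for v
    proof -
      have "quad m (mat_app id N v) = quad m (\<lambda>r. \<Sum>s = 1..?n. N $$ (r - 1, s - 1) * v s)"
        using N by (simp add: mat_app_def[abs_def])
      also have "\<dots> = quad m (\<lambda>r. \<Sum>s = 1..?n. unit_fun s r * v s)"
        by (rule quad_sum_cong) (use R gram_eq_iff[OF N] in blast)+
      also have "\<dots> = quad m v"
      proof (rule quad_cong)
        fix r assume r: "r \<in> {1..?n}"
        have "(\<Sum>s = 1..?n. unit_fun s r * v s) = (\<Sum>s = 1..?n. if s = r then v s else 0)"
          by (intro sum.cong) (auto simp: unit_fun_def)
        then show "(\<Sum>s = 1..?n. unit_fun s r * v s) = v r" using r by simp
      qed
      finally show ?thesis .
    qed
    then show "N \<in> isometry_group m" using True by (simp add: isometry_group_def)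
  qed
qed (simp add: isometry_group_def)

text \<open>These columns are zero in the first m rows, so every product of partner coordinates
  vanishes. Only the first m columns carry a condition, which is why \<open>G_even\<close> restricts
  s_ii just for i \<le> m.\<close>

lemma unitri_quad_column:
  assumes "N \<in> unitri (2*m + 1)" "s \<in> {m + 1..2*m + 1}"
  shows "quad m (\<lambda>r. N $$ (r - 1, s - 1)) = quad m (unit_fun s)"
proof -
  have z: "N $$ (l - 1, s - 1) = 0" if "l \<in> {1..m}" for l
    using assms that unfolding unitri_def by auto
  have "N $$ (m, s - 1) = (if s = m + 1 then 1 else 0)"
    using assms by (auto simp: unitri_def)
  moreover have "(\<Sum>l = 1..m. N $$ (l - 1, s - 1) * N $$ (2*m + 2 - l - 1, s - 1)) = 0"
    by (intro sum.neutral ballI) (simp only: z mult_zero_left)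
  ultimately have "quad m (\<lambda>r. N $$ (r - 1, s - 1)) = (if s = m + 1 then 1 else 0)"
    unfolding quad_def by simp
  then show ?thesis using assms(2) by (simp add: quad_unit_fun)
qed

text \<open>Since \<open>bil m x x = 2 * quad m x\<close>, the Gram condition forces the column
  conditions once 2 can be cancelled.\<close>

lemma G_odd_eq_isometry_group:
  assumes two: "(2 :: 'a::{field, finite}) \<noteq> 0"
  shows "(G_odd m :: 'a mat set) = isometry_group m"
proof -
  have "quad m (\<lambda>r. N $$ (r - 1, s - 1)) = quad m (unit_fun s)"
    if N: "N \<in> unitri (2*m + 1)" "transpose_mat N * Y_mat m 2 * N = Y_mat m 2"
      and s: "s \<in> {1..2*m + 1}" for N :: "'a mat" and s
  proof -
    have "N \<in> carrier_mat (2*m + 1) (2*m + 1)" using N by (simp add: unitri_def)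
    then have "2 * quad m (\<lambda>r. N $$ (r - 1, s - 1)) = 2 * quad m (unit_fun s)"
      using N(2) s by (simp add: gram_eq_iff flip: bil_self)
    then show ?thesis using two by simp
  qed
  then show ?thesis by (auto simp: G_odd_def isometry_group_iff)
qed

lemma antidiag_product_diagonal:
  fixes A C :: "'a::field mat"
  assumes "A \<in> carrier_mat m m" "C \<in> carrier_mat m m" "i < m"
  shows "(transpose_mat A * antidiag m * C) $$ (i, i) = (\<Sum>l = 1..m. A $$ (l - 1, i) * C $$ (m - l, i))"
proof -
  have J: "(antidiag m :: 'a mat) \<in> carrier_mat m m" by (simp add: antidiag_def)
  have row: "(\<Sum>k<m. antidiag m $$ (j, k) * C $$ (k, i)) = C $$ (m - 1 - j, i)" if "j < m" for j
  proof -
    have "(\<Sum>k<m. antidiag m $$ (j, k) * C $$ (k, i)) = (\<Sum>k<m. if k = m - 1 - j then C $$ (k, i) else 0)"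
      using that by (intro sum.cong) (auto simp: antidiag_def)
    then show ?thesis using that by (simp add: sum.delta)
  qed
  have "(transpose_mat A * antidiag m * C) $$ (i, i) = (transpose_mat A * (antidiag m * C)) $$ (i, i)"
    using assms J by (metis assoc_mult_mat transpose_carrier_mat)
  also have "\<dots> = (\<Sum>j<m. A $$ (j, i) * (\<Sum>k<m. antidiag m $$ (j, k) * C $$ (k, i)))"
    using assms J carrier_matD[OF J] by (simp add: scalar_prod_def atLeast0LessThan)
  also have "\<dots> = (\<Sum>j<m. A $$ (j, i) * C $$ (m - 1 - j, i))"
    by (rule sum.cong) (simp_all only: row lessThan_iff)
  also have "\<dots> = (\<Sum>l = 1..m. A $$ (l - 1, i) * C $$ (m - l, i))"
    by (rule sum.reindex_bij_witness[of _ "\<lambda>l. l - 1" Suc]) auto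
  finally show ?thesis .
qed

text \<open>The entry s_ii is the sum of partner products in column \<open>i\<close>, and b_1i is
  its middle coordinate; in characteristic 2 equality of s_ii and b_1i^2 says that their sum, the
  value of \<open>quad\<close>, is zero.\<close>

lemma block_diagonal_condition:
  fixes A B C :: "'a::{field, finite} mat"
  assumes two: "(2 :: 'a) = 0"
    and A: "A \<in> carrier_mat m m" "C \<in> carrier_mat m m"
    and blocks: "\<And>k. k < m \<Longrightarrow> A $$ (k, i) = N $$ (k, i)" "B $$ (0, i) = N $$ (m, i)"
      "\<And>k. k < m \<Longrightarrow> C $$ (k, i) = N $$ (m + 1 + k, i)"
    and i: "i < m"
  shows "(transpose_mat A * antidiag m * C) $$ (i, i) = (B $$ (0, i))\<^sup>2 \<longleftrightarrow>
    quad m (\<lambda>r. N $$ (r - 1, i)) = 0"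
proof -
  have char2: "x + y = 0 \<longleftrightarrow> x = y" for x y :: 'a
  proof -
    have "y + y = 0" using two by (metis mult_2 mult_zero_left)
    then show ?thesis by (metis add_right_cancel)
  qed
  have "A $$ (l - 1, i) * C $$ (m - l, i) = N $$ (l - 1, i) * N $$ (2*m + 2 - l - 1, i)"
    if "l \<in> {1..m}" for l
  proof -
    have "2*m + 2 - l - 1 = m + 1 + (m - l)" "l - 1 < m" "m - l < m" using that by auto
    then show ?thesis by (simp only: blocks)
  qed
  then have "(transpose_mat A * antidiag m * C) $$ (i, i) + (B $$ (0, i))\<^sup>2
      = quad m (\<lambda>r. N $$ (r - 1, i))"
    by (simp add: antidiag_product_diagonal[OF A i] quad_def blocks(2))
  then show ?thesis using char2 by metis
qed

text \<open>In characteristic 2 the matrices Y and Y_0 coincide, and every unitriangular matrix has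
  the required block shape. What remains is the diagonal condition, that is, \<open>quad\<close> on
  the first m columns.\<close>

lemma G_even_eq_isometry_group:
  assumes two: "(2 :: 'a::{field, finite}) = 0"
  shows "(G_even m :: 'a mat set) = isometry_group m"
proof (rule Set.set_eqI)
  let ?n = "2*m + 1"
  fix N :: "'a mat"
  show "N \<in> G_even m \<longleftrightarrow> N \<in> isometry_group m"
  proof
    assume "N \<in> G_even m"
    then obtain A B C D E where N: "N \<in> unitri ?n" and
      bl: "A \<in> unitri m" "B \<in> carrier_mat 1 m" "C \<in> carrier_mat m m" "D \<in> carrier_mat m 1"
        "E \<in> unitri m" and
      eq: "N = three_block_mat A (0\<^sub>m m 1) (0\<^sub>m m m) B (1\<^sub>m 1) (0\<^sub>m 1 m) C D E" and
      gram: "transpose_mat N * Y_mat m 0 * N = Y_mat m 0" and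
      diag: "\<And>i. i < m \<Longrightarrow> (transpose_mat A * antidiag m * C) $$ (i, i) = (B $$ (0, i))\<^sup>2"
      unfolding G_even_def by blast
    have AE: "A \<in> carrier_mat m m" "E \<in> carrier_mat m m" using bl by (auto simp: unitri_def)
    have idx: "N $$ (i, j) =
      (if i < m then if j < m then A $$ (i, j) else if j = m then 0\<^sub>m m 1 $$ (i, 0) else 0\<^sub>m m m $$ (i, j - m - 1)
       else if i = m then if j < m then B $$ (0, j) else if j = m then 1\<^sub>m 1 $$ (0, 0) else 0\<^sub>m 1 m $$ (0, j - m - 1)
       else if j < m then C $$ (i - m - 1, j) else if j = m then D $$ (i - m - 1, 0)
         else E $$ (i - m - 1, j - m - 1))" if "i < ?n" "j < ?n" for i j
      unfolding eq by (rule three_block_mat_index) (use AE bl that in auto)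
    have "quad m (\<lambda>r. N $$ (r - 1, s - 1)) = quad m (unit_fun s)" if s: "s \<in> {1..?n}" for s
    proof (cases "s \<le> m")
      case True
      then have "quad m (\<lambda>r. N $$ (r - 1, s - 1)) = 0"
        using s block_diagonal_condition[OF two AE(1) bl(3), of "s - 1" N B] diag[of "s - 1"]
        by (simp add: idx)
      then show ?thesis using True s by (simp add: quad_unit_fun)
    next
      case False
      then show ?thesis using unitri_quad_column[OF N, of s] s by simp
    qed
    then show "N \<in> isometry_group m"
      using N gram two by (simp add: isometry_group_iff)
  next
    assume "N \<in> isometry_group m"
    then have N: "N \<in> unitri ?n" and gram: "transpose_mat N * Y_mat m 2 * N = Y_mat m 2"
      and quad: "\<And>s. s \<in> {1..?n} \<Longrightarrow> quad m (\<lambda>r. N $$ (r - 1, s - 1)) = quad m (unit_fun s)"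
      by (auto simp: isometry_group_iff)
    define A where "A = mat m m (\<lambda>(i, j). N $$ (i, j))"
    define B where "B = mat 1 m (\<lambda>(i, j). N $$ (m, j))"
    define C where "C = mat m m (\<lambda>(i, j). N $$ (m + 1 + i, j))"
    define D where "D = mat m 1 (\<lambda>(i, j). N $$ (m + 1 + i, m))"
    define E where "E = mat m m (\<lambda>(i, j). N $$ (m + 1 + i, m + 1 + j))"
    have carr: "A \<in> carrier_mat m m" "B \<in> carrier_mat 1 m" "C \<in> carrier_mat m m"
      "D \<in> carrier_mat m 1" "E \<in> carrier_mat m m"
      by (auto simp: A_def B_def C_def D_def E_def)
    have AE: "A \<in> unitri m" "E \<in> unitri m"
      using N by (auto simp: A_def E_def unitri_def)
    have eq: "N = three_block_mat A (0\<^sub>m m 1) (0\<^sub>m m m) B (1\<^sub>m 1) (0\<^sub>m 1 m) C D E"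
    proof (rule eq_matI)
      let ?T = "three_block_mat A (0\<^sub>m m 1) (0\<^sub>m m m) B (1\<^sub>m 1) (0\<^sub>m 1 m) C D E"
      have T: "?T \<in> carrier_mat ?n ?n"
        by (rule three_block_mat_carrier) (use carr in auto)
      then show "dim_row N = dim_row ?T" "dim_col N = dim_col ?T"
        using N by (auto simp: unitri_def)
      fix i j assume "i < dim_row ?T" "j < dim_col ?T"
      then have ij: "i < ?n" "j < ?n" using T by auto
      show "N $$ (i, j) = ?T $$ (i, j)"
        by (subst three_block_mat_index)
          (use carr ij N in \<open>auto simp: A_def B_def C_def D_def E_def unitri_def\<close>)
    qed
    have "(transpose_mat A * antidiag m * C) $$ (i, i) = (B $$ (0, i))\<^sup>2" if "i < m" for i
    proof -
      have "quad m (\<lambda>r. N $$ (r - 1, i)) = 0"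
        using quad[of "i + 1"] that by (simp add: quad_unit_fun)
      then show ?thesis
        using that block_diagonal_condition[OF two carr(1,3), of i N B]
        by (simp add: A_def B_def C_def)
    qed
    moreover have "transpose_mat N * Y_mat m 0 * N = Y_mat m 0" using gram two by simp
    ultimately show "N \<in> G_even m"
      using N AE carr eq unfolding G_even_def by blast
  qed
qed

lemma sylow_G_eq_isometry_group: "(sylow_G m :: 'a::{field, finite} mat set) = isometry_group m"
  unfolding sylow_G_def
  by (simp add: even_card_iff G_odd_eq_isometry_group G_even_eq_isometry_group)

section \<open>Rational functions and generated fields\<close>

lemma
  shows of_pol_add: "of_pol (f + g) = of_pol f + of_pol g"
    and of_pol_mult: "of_pol (f * g) = of_pol f * of_pol g"
    and of_pol_zero: "of_pol 0 = 0"
    and of_pol_one: "of_pol 1 = 1"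
  by (simp_all add: of_pol_def Zero_fract_def One_fract_def)

lemma of_pol_eq_iff: "of_pol f = of_pol g \<longleftrightarrow> f = g"
  by (simp add: of_pol_def eq_fract)

lemma of_pol_sum: "of_pol (sum F A) = (\<Sum>i\<in>A. of_pol (F i))"
  by (induction A rule: infinite_finite_induct) (simp_all add: of_pol_zero of_pol_add)

lemma of_pol_prod: "of_pol (prod F A) = (\<Prod>i\<in>A. of_pol (F i))"
  by (induction A rule: infinite_finite_induct) (simp_all add: of_pol_one of_pol_mult)

lemma of_pol_power: "of_pol (f ^ k) = of_pol f ^ k"
  by (induction k) (simp_all add: of_pol_one of_pol_mult)

lemma Fract_eq_divide: "Fract a b = of_pol a / of_pol b"
  by (simp add: of_pol_def divide_fract)

abbreviation rconst :: "'a::{field, finite} \<Rightarrow> 'a mpol fract" where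
  "rconst c \<equiv> of_pol (Const c)"

abbreviation rvar :: "nat \<Rightarrow> 'a::{field, finite} mpol fract" where
  "rvar i \<equiv> of_pol (Var i)"

text \<open>From here on the unqualified facts of the locale refer to the constants inside the field
  of rational functions.\<close>

interpretation scalars "rconst :: 'a::{field, finite} \<Rightarrow> 'a mpol fract"
  by unfold_locales (simp_all add: Const_simps of_pol_add of_pol_mult of_pol_one)

lemma lookup_linear_form:
  assumes "finite I" "j \<in> I"
  shows "Poly_Mapping.lookup (\<Sum>l\<in>I. Const (c l) * Var l) (Poly_Mapping.single j 1) = c j"
proof -
  have "Const (c l) * Var l = Poly_Mapping.single (Poly_Mapping.single l 1) (c l)" for l
    by (simp add: Const_def Var_def mult_single)
  moreover have "Poly_Mapping.single l (1 :: nat) = Poly_Mapping.single j 1 \<longleftrightarrow> l = j" for l j :: nat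
    by (metis lookup_single_eq lookup_single_not_eq zero_neq_one)
  ultimately have "Poly_Mapping.lookup (\<Sum>l\<in>I. Const (c l) * Var l) (Poly_Mapping.single j 1)
      = (\<Sum>l\<in>I. if l = j then c l else 0)"
    by (simp add: lookup_sum lookup_single when_def)
  then show ?thesis using assms by simp
qed

lemma lin_indep_rvar:
  assumes "finite I"
  shows "lin_indep (rvar :: nat \<Rightarrow> 'a::{field, finite} mpol fract) I"
  unfolding lin_indep_def
proof (intro allI impI ballI)
  fix c :: "nat \<Rightarrow> 'a" and j
  assume "(\<Sum>l\<in>I. rconst (c l) * rvar l) = 0" "j \<in> I"
  then have "of_pol (\<Sum>l\<in>I. Const (c l) * Var l) = of_pol 0"
    by (simp add: of_pol_sum of_pol_mult of_pol_zero)
  then show "c j = 0"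
    using lookup_linear_form[OF assms \<open>j \<in> I\<close>, of c] by (simp add: of_pol_eq_iff)
qed

lemma rvar_notin_lin_span:
  assumes "finite I" "j \<notin> I"
  shows "rvar j \<notin> lin_span (rvar :: nat \<Rightarrow> 'a::{field, finite} mpol fract) I"
proof
  assume "rvar j \<in> lin_span (rvar :: nat \<Rightarrow> 'a mpol fract) I"
  then obtain c :: "nat \<Rightarrow> 'a" where c: "rvar j = (\<Sum>l\<in>I. rconst (c l) * rvar l)"
    unfolding lin_span_def by blast
  \<comment> \<open>Moving x_j to the other side gives a linear relation on
    \<open>insert j I\<close> with coefficient -1 at \<open>j\<close>, contrary to
    independence.\<close>
  define d where "d l = (if l = j then - 1 else c l)" for l
  have "(\<Sum>l\<in>insert j I. rconst (d l) * rvar l) = rconst (- 1) * rvar j + (\<Sum>l\<in>I. rconst (c l) * rvar l)"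
    using assms by (simp add: d_def) (intro sum.cong, auto)
  also have "\<dots> = 0" by (simp add: scalar_uminus scalar_one flip: c)
  finally have "d j = 0"
    using lin_indep_rvar[of "insert j I"] assms(1) unfolding lin_indep_def by blast
  then show False by (simp add: d_def)
qed

text \<open>\<open>field_adjoin\<close> is built on the record-based \<open>generate_field\<close>;
  these equations carry its closure rules over to type class arithmetic.\<close>

lemma type_algebra_ops:
  fixes x y :: "'b::field"
  defines "R \<equiv> ring_of_type_algebra :: 'b ring"
  shows "\<one>\<^bsub>R\<^esub> = 1" "\<zero>\<^bsub>R\<^esub> = 0" "x \<oplus>\<^bsub>R\<^esub> y = x + y" "x \<otimes>\<^bsub>R\<^esub> y = x * y" "carrier R = UNIV"
    "\<ominus>\<^bsub>R\<^esub> x = - x" "x \<noteq> 0 \<Longrightarrow> inv\<^bsub>R\<^esub> x = inverse x"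
proof -
  interpret R: field R unfolding R_def by (rule field_from_type_algebra)
  show ops: "\<one>\<^bsub>R\<^esub> = 1" "\<zero>\<^bsub>R\<^esub> = 0" "x \<oplus>\<^bsub>R\<^esub> y = x + y" "x \<otimes>\<^bsub>R\<^esub> y = x * y" "carrier R = UNIV" for x y
    by (simp_all add: R_def ring_of_type_algebra_def)
  show "\<ominus>\<^bsub>R\<^esub> x = - x" by (rule R.minus_equality) (simp_all add: ops)
  show "inv\<^bsub>R\<^esub> x = inverse x" if "x \<noteq> 0" by (rule R.comm_inv_char) (simp_all add: ops that)
qed

lemma is_subfield_field_adjoin: "is_subfield (field_adjoin S)"
proof -
  let ?R = "ring_of_type_algebra :: 'a mpol fract ring"
  interpret R: field ?R by (rule field_from_type_algebra)
  let ?H = "of_pol ` (range Const \<union> S)"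
  note ops = type_algebra_ops[where ?'b = "'a mpol fract"]
  have zero: "0 \<in> generate_field ?R ?H"
    using R.zero_in_generate[of ?H] by (simp add: ops)
  have one: "1 \<in> generate_field ?R ?H"
    using generate_field.one[of ?R ?H] by (simp add: ops)
  have inverse: "inverse x \<in> generate_field ?R ?H" if "x \<in> generate_field ?R ?H" for x
    using generate_field.m_inv[OF that] zero by (cases "x = 0") (simp_all add: ops)
  have uminus: "- x \<in> generate_field ?R ?H" if "x \<in> generate_field ?R ?H" for x
    using generate_field.a_inv[OF that] by (simp add: ops)
  have add_mult: "x + y \<in> generate_field ?R ?H" "x * y \<in> generate_field ?R ?H"
    if "x \<in> generate_field ?R ?H" "y \<in> generate_field ?R ?H" for x y
    using generate_field.eng_add[OF that] generate_field.eng_mult[OF that] by (simp_all add: ops)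
  show ?thesis
    unfolding field_adjoin_def by (rule is_subfieldI) (fact zero one add_mult uminus inverse)+
qed

lemma field_adjoin_incl: "s \<in> S \<Longrightarrow> of_pol s \<in> field_adjoin S"
  unfolding field_adjoin_def by (rule generate_field.incl) blast

lemma rconst_in_field_adjoin: "rconst c \<in> field_adjoin S"
  unfolding field_adjoin_def by (rule generate_field.incl) blast

lemma field_adjoin_minimal:
  assumes E: "is_subfield E" and "range (\<lambda>c. of_pol (Const c)) \<subseteq> E" "of_pol ` S \<subseteq> E"
  shows "field_adjoin S \<subseteq> E"
proof
  let ?R = "ring_of_type_algebra :: 'a mpol fract ring"
  note ops = type_algebra_ops[where ?'b = "'a mpol fract"]
  fix x assume "x \<in> field_adjoin S"
  then have "x \<in> generate_field ?R (of_pol ` (range Const \<union> S))" by (simp add: field_adjoin_def)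
  then show "x \<in> E"
  proof (induction rule: generate_field.induct)
    case one
    then show ?case using subfield_one[OF E] by (simp add: ops)
  next
    case (incl h)
    then show ?case using assms(2,3) by auto
  next
    case (a_inv h)
    then show ?case by (simp add: ops subfield_uminus[OF E])
  next
    case (m_inv h)
    then show ?case by (simp add: ops subfield_inverse[OF E])
  next
    case (eng_add h1 h2)
    then show ?case by (simp add: ops subfield_add[OF E])
  next
    case (eng_mult h1 h2)
    then show ?case by (simp add: ops subfield_mult[OF E])
  qed
qed

text \<open>By minimality F(S, v) is contained in the simple extension F(S)(v); its elements thus
  have the quotient form on which \<open>descent_step\<close> operates.\<close>

lemma field_adjoin_insertE:
  fixes v :: "'a::{field, finite} mpol"
  assumes "x \<in> field_adjoin (insert v S)"
  obtains a b where "a \<in> polys_over (field_adjoin S)" "b \<in> polys_over (field_adjoin S)"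
    "poly b (of_pol v) \<noteq> 0" "x = poly a (of_pol v) / poly b (of_pol v)"
proof -
  let ?E = "field_adjoin S"
  let ?K = "{poly a (of_pol v) / poly b (of_pol v) | a b.
    a \<in> polys_over ?E \<and> b \<in> polys_over ?E \<and> poly b (of_pol v) \<noteq> 0}"
  note E = is_subfield_field_adjoin[of S]
  have I: "poly a (of_pol v) / poly b (of_pol v) \<in> ?K"
    if "a \<in> polys_over ?E" "b \<in> polys_over ?E" "poly b (of_pol v) \<noteq> 0" for a b
    using that by blast
  have const: "y \<in> ?K" if "y \<in> ?E" for y
    using I[of "[:y:]" 1] that polys_over_pCons[OF E that polys_over_zero[OF E]] polys_over_one[OF E]
    by simp
  have v: "of_pol v \<in> ?K"
    using I[of "[:0, 1:]" 1] polys_over_one[OF E]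
      polys_over_pCons[OF E subfield_zero[OF E] polys_over_one[OF E]]
    by (simp add: one_pCons)
  have "field_adjoin (insert v S) \<subseteq> ?K"
  proof (rule field_adjoin_minimal[OF is_subfield_simple_extension[OF E]])
    show "range (\<lambda>c. of_pol (Const c)) \<subseteq> ?K"
      using const[OF rconst_in_field_adjoin] by (intro image_subsetI)
    show "of_pol ` insert v S \<subseteq> ?K"
    proof (rule image_subsetI)
      fix y assume "y \<in> insert v S"
      then show "of_pol y \<in> ?K"
        using v const[OF field_adjoin_incl, of y] by (cases "y = v") simp_all
    qed
  qed
  then have "x \<in> ?K" using assms by (rule subsetD)
  then show ?thesis by (elim CollectE exE conjE) (rule that)
qed

section \<open>The field of rational functions in n variables\<close>

lemma polys_closed:
  assumes "f \<in> polys n" "g \<in> polys n"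
  shows "f + g \<in> polys n" "f * g \<in> polys n"
proof -
  show "f + g \<in> polys n"
    using assms Poly_Mapping.keys_add[of f g] unfolding polys_def by blast
  show "f * g \<in> polys n"
    unfolding polys_def
  proof (intro CollectI ballI)
    fix t assume "t \<in> Poly_Mapping.keys (f * g)"
    then obtain a b where "t = a + b" "a \<in> Poly_Mapping.keys f" "b \<in> Poly_Mapping.keys g"
      using keys_mult[of f g] by blast
    then show "Poly_Mapping.keys t \<subseteq> {1..n}"
      using assms Poly_Mapping.keys_add[of a b] unfolding polys_def by blast
  qed
qed

lemma Const_in_polys: "Const c \<in> polys n"
  by (auto simp: polys_def Const_def)

lemma Var_in_polys: "i \<in> {1..n} \<Longrightarrow> Var i \<in> polys n"
  by (auto simp: polys_def Var_def)

lemma of_pol_in_ratfuns: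
  assumes "p \<in> polys n"
  shows "of_pol p \<in> ratfuns n"
proof -
  have "1 \<in> polys n" using Const_in_polys[of 1 n] by (simp add: Const_simps)
  then have "\<exists>a b. Fract p 1 = Fract a b \<and> a \<in> polys n \<and> b \<in> polys n \<and> b \<noteq> 0"
    using assms by (intro exI[of _ p] exI[where x = 1]) simp
  then show ?thesis unfolding ratfuns_def of_pol_def by blast
qed

lemma is_subfield_ratfuns: "is_subfield (ratfuns n :: 'a::field mpol fract set)"
proof -
  have one: "(1 :: 'a mpol) \<in> polys n" and zero: "(0 :: 'a mpol) \<in> polys n"
    and neg: "(- 1 :: 'a mpol) \<in> polys n"
  proof -
    show "(1 :: 'a mpol) \<in> polys n" "(0 :: 'a mpol) \<in> polys n"
      using Const_in_polys[of "1 :: 'a" n] Const_in_polys[of "0 :: 'a" n] by (simp_all add: Const_simps)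
    have "Const (1 :: 'a) + Const (- 1) = 0"
      by (metis Const_simps(1,3) add.right_inverse)
    then have "Const (- 1 :: 'a) = - 1" by (metis Const_simps(2) add.inverse_unique)
    then show "(- 1 :: 'a mpol) \<in> polys n" by (metis Const_in_polys)
  qed
  have I: "Fract a b \<in> ratfuns n" if "a \<in> polys n" "b \<in> polys n" "b \<noteq> 0" for a b :: "'a mpol"
    using that unfolding ratfuns_def by blast
  have E: "\<exists>a b. x = Fract a b \<and> a \<in> polys n \<and> b \<in> polys n \<and> b \<noteq> 0"
    if "x \<in> ratfuns n" for x :: "'a mpol fract"
    using that unfolding ratfuns_def by blast
  have add_mult: "x + y \<in> ratfuns n" "x * y \<in> ratfuns n"
    if x: "x \<in> ratfuns n" and y: "y \<in> ratfuns n" for x y :: "'a mpol fract"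
  proof -
    obtain a b c d where *: "x = Fract a b" "y = Fract c d" "a \<in> polys n" "b \<in> polys n"
      "c \<in> polys n" "d \<in> polys n" "b \<noteq> 0" "d \<noteq> 0"
      using E[OF x] E[OF y] by metis
    have "x + y = Fract (a * d + c * b) (b * d)" "x * y = Fract (a * c) (b * d)" "b * d \<noteq> 0"
      using * by simp_all
    moreover have "a * d + c * b \<in> polys n" "b * d \<in> polys n" "a * c \<in> polys n"
      by (intro polys_closed *)+
    ultimately show "x + y \<in> ratfuns n" "x * y \<in> ratfuns n" by (simp_all only: I not_False_eq_True)
  qed
  have inv: "- x \<in> ratfuns n" "inverse x \<in> ratfuns n" if x: "x \<in> ratfuns n" for x :: "'a mpol fract"
  proof -
    obtain a b where *: "x = Fract a b" "a \<in> polys n" "b \<in> polys n" "b \<noteq> 0"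
      using E[OF x] by metis
    have "- x = Fract (- 1 * a) b" by (simp add: *)
    then show "- x \<in> ratfuns n" using I[of "- 1 * a" b] * polys_closed(2)[OF neg *(2)] by simp
    have z: "(0 :: 'a mpol fract) \<in> ratfuns n" using I[OF zero one] by (simp add: Zero_fract_def)
    show "inverse x \<in> ratfuns n"
      using I[of b a] * z by (cases "a = 0") (simp_all add: Fract_eq_divide of_pol_zero)
  qed
  have "(0 :: 'a mpol fract) \<in> ratfuns n" "(1 :: 'a mpol fract) \<in> ratfuns n"
    using I[OF zero one] I[OF one one] by (simp_all add: Zero_fract_def One_fract_def)
  then show ?thesis using add_mult inv by (rule is_subfieldI)
qed

text \<open>The starting point of the descent: with all variables adjoined, the generated field
  contains every rational function.\<close>

lemma ratfuns_subset_field_adjoin: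
  assumes "Var ` {1..n} \<subseteq> S"
  shows "ratfuns n \<subseteq> (field_adjoin S :: 'a::{field, finite} mpol fract set)"
proof
  note E = is_subfield_field_adjoin[of S]
  have pol: "of_pol p \<in> field_adjoin S" if p: "p \<in> polys n" for p :: "'a mpol"
  proof -
    have var: "rvar i \<in> field_adjoin S" if "t \<in> Poly_Mapping.keys p" "i \<in> Poly_Mapping.keys t" for t i
    proof -
      have "i \<in> {1..n}" using that p unfolding polys_def by blast
      then show ?thesis using assms by (intro field_adjoin_incl) blast
    qed
    \<comment> \<open>Substituting each variable for itself writes \<open>p\<close> as the sum of
      its monomials.\<close>
    have "of_pol p = of_pol (poly_subst Var p)" by (simp add: poly_subst_Var_id)
    also have "\<dots> = (\<Sum>t\<in>Poly_Mapping.keys p. rconst (Poly_Mapping.lookup p t) *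
        (\<Prod>i\<in>Poly_Mapping.keys t. rvar i ^ Poly_Mapping.lookup t i))"
      by (simp add: poly_subst_def monom_subst_def of_pol_sum of_pol_mult of_pol_prod of_pol_power)
    also have "\<dots> \<in> field_adjoin S"
      using var by (intro subfield_sum[OF E] subfield_mult[OF E] subfield_prod[OF E]
          subfield_power[OF E] rconst_in_field_adjoin)
    finally show ?thesis .
  qed
  fix x :: "'a mpol fract" assume "x \<in> ratfuns n"
  then obtain a b where "x = Fract a b" "a \<in> polys n" "b \<in> polys n"
    unfolding ratfuns_def by blast
  then show "x \<in> field_adjoin S"
    using pol subfield_divide[OF E] by (simp add: Fract_eq_divide)
qed

section \<open>The action on rational functions\<close>

lemma isometry_matD: "N \<in> isometry_group m \<Longrightarrow> N \<in> carrier_mat (2*m + 1) (2*m + 1)"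
  by (simp add: isometry_group_def unitri_def)

lemma act_frac_of_pol:
  assumes "g \<in> (isometry_group m :: 'a::{field, finite} mat set)"
  shows "act_frac g (of_pol f) = of_pol (act g f)"
proof -
  obtain g' where "g' \<in> isometry_group m" "g * g' = 1\<^sub>m (2*m + 1)" "g' * g = 1\<^sub>m (2*m + 1)"
    using isometry_inverse[OF assms] .
  then show ?thesis
    using act_frac_Fract[OF isometry_matD[OF assms] isometry_matD, of g' 1 f]
    by (simp add: of_pol_def act_def)
qed

lemma ring_endo_act_frac:
  assumes "g \<in> (isometry_group m :: 'a::{field, finite} mat set)"
  shows "ring_endo (act_frac g)"
proof -
  obtain g' where g': "g' \<in> isometry_group m" "g * g' = 1\<^sub>m (2*m + 1)" "g' * g = 1\<^sub>m (2*m + 1)"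
    using isometry_inverse[OF assms] .
  note dims = isometry_matD[OF assms] isometry_matD[OF g'(1)]
  have frac: "act_frac g (Fract a b) = Fract (act g a) (act g b)" if "b \<noteq> 0" for a b
    by (rule act_frac_Fract[OF dims g'(2,3) that])
  have nz: "act g b \<noteq> 0" if "b \<noteq> 0" for b
  proof
    assume "act g b = 0"
    then have "act g' (act g b) = 0" by (simp add: act_def)
    then show False using act_act_inverse[OF dims(2,1) g'(3,2)] that by simp
  qed
  have "act_frac g (x + y) = act_frac g x + act_frac g y \<and>
        act_frac g (x * y) = act_frac g x * act_frac g y" for x y
  proof -
    obtain a b c d where *: "x = Fract a b" "b \<noteq> 0" "y = Fract c d" "d \<noteq> 0"
      by (metis Fract_cases)
    then show ?thesis
      using nz by (simp add: frac) (simp add: act_def poly_subst_add poly_subst_mult)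
  qed
  moreover have "act_frac g 1 = 1"
    using act_frac_of_pol[OF assms, of 1] by (simp add: of_pol_one act_def)
  ultimately show ?thesis unfolding ring_endo_def by blast
qed

lemma act_frac_rconst: "g \<in> isometry_group m \<Longrightarrow> act_frac g (rconst c) = rconst c"
  by (simp add: act_frac_of_pol act_def)

text \<open>The action is defined through the inverse matrix \<open>g'\<close>, so x_r goes to the
  r-th coordinate of g' x. As the isometries are closed under inverses, the next two lemmas replace
  \<open>g'\<close> by an arbitrary isometry.\<close>

lemma act_frac_rvar:
  assumes "g \<in> (isometry_group m :: 'a::{field, finite} mat set)" "g' \<in> isometry_group m"
    "g * g' = 1\<^sub>m (2*m + 1)" "g' * g = 1\<^sub>m (2*m + 1)" "r \<in> {1..2*m + 1}"
  shows "act_frac g (rvar r) = mat_app rconst g' rvar r"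
proof -
  note dims = isometry_matD[OF assms(1)] isometry_matD[OF assms(2)]
  have inv: "mat_inverse g = Some g'"
    by (rule mat_inverse_invertible[OF dims assms(3,4)])
  have "act g (Var r) = (\<Sum>j = 1..2*m + 1. Const (g' $$ (r - 1, j - 1)) * Var j)"
    using assms(5) dims carrier_matD[OF dims(1)] unfolding act_def poly_subst_Var act_var_def inv by simp
  then show ?thesis
    using carrier_matD[OF dims(2)]
    by (simp only: act_frac_of_pol[OF assms(1)] mat_app_def of_pol_sum of_pol_mult)
qed

lemma act_frac_rvar_ex:
  assumes "g \<in> (isometry_group m :: 'a::{field, finite} mat set)"
  obtains N where "N \<in> isometry_group m"
    "\<And>r. r \<in> {1..2*m + 1} \<Longrightarrow> act_frac g (rvar r) = mat_app rconst N rvar r"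
proof -
  obtain g' where "g' \<in> isometry_group m" "g * g' = 1\<^sub>m (2*m + 1)" "g' * g = 1\<^sub>m (2*m + 1)"
    using isometry_inverse[OF assms] .
  then show ?thesis using that act_frac_rvar[OF assms, of g'] by blast
qed

lemma act_frac_rvar_realize:
  assumes "N \<in> (isometry_group m :: 'a::{field, finite} mat set)"
  obtains g where "g \<in> isometry_group m"
    "\<And>r. r \<in> {1..2*m + 1} \<Longrightarrow> act_frac g (rvar r) = mat_app rconst N rvar r"
proof -
  obtain g where "g \<in> isometry_group m" "N * g = 1\<^sub>m (2*m + 1)" "g * N = 1\<^sub>m (2*m + 1)"
    using isometry_inverse[OF assms] .
  then show ?thesis using that act_frac_rvar[OF _ assms, of g] by blast
qed

lemma ring_endo_sum: "ring_endo \<sigma> \<Longrightarrow> \<sigma> (sum F A) = (\<Sum>i\<in>A. \<sigma> (F i))"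
  by (induction A rule: infinite_finite_induct) (simp_all add: ring_endo_zero ring_endo_add)

lemma ring_endo_prod: "ring_endo \<sigma> \<Longrightarrow> \<sigma> (prod F A) = (\<Prod>i\<in>A. \<sigma> (F i))"
  by (induction A rule: infinite_finite_induct) (simp_all add: ring_endo_one ring_endo_mult)

lemma ring_endo_power: "ring_endo \<sigma> \<Longrightarrow> \<sigma> (x ^ k) = \<sigma> x ^ k"
  by (induction k) (simp_all add: ring_endo_one ring_endo_mult)

lemma ring_endo_2: "ring_endo \<sigma> \<Longrightarrow> \<sigma> 2 = 2"
  by (metis one_add_one ring_endo_add ring_endo_one)

lemma ring_endo_inj: "ring_endo \<sigma> \<Longrightarrow> inj \<sigma>"
proof (rule injI)
  fix x y assume \<sigma>: "ring_endo \<sigma>" and eq: "\<sigma> x = \<sigma> y"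
  have "\<sigma> (x - y) = 0"
    using eq ring_endo_add[OF \<sigma>, of x "- y"] by (simp add: ring_endo_uminus[OF \<sigma>])
  show "x = y"
  proof (rule ccontr)
    assume "x \<noteq> y"
    then have "\<sigma> (x - y) * \<sigma> (inverse (x - y)) = 1"
      by (simp add: ring_endo_one[OF \<sigma>] flip: ring_endo_mult[OF \<sigma>])
    then show False using \<open>\<sigma> (x - y) = 0\<close> by simp
  qed
qed

lemma ring_endo_quad: "ring_endo \<sigma> \<Longrightarrow> \<sigma> (quad m x) = quad m (\<lambda>r. \<sigma> (x r))"
  by (simp add: quad_def ring_endo_add ring_endo_sum ring_endo_mult ring_endo_power)

lemma ring_endo_bil: "ring_endo \<sigma> \<Longrightarrow> \<sigma> (bil m x y) = bil m (\<lambda>r. \<sigma> (x r)) (\<lambda>r. \<sigma> (y r))"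
  by (simp add: bil_def ring_endo_add ring_endo_sum ring_endo_mult ring_endo_2)

lemma of_pol_2: "of_pol 2 = 2"
  by (metis of_pol_add of_pol_one one_add_one)

lemma of_pol_h_1: "of_pol (h m 1) = quad m rvar"
  by (simp add: h_def quad_def of_pol_add of_pol_sum of_pol_mult of_pol_power mult.commute)

text \<open>The exponent in h_k is q^(k-1), hence the shift of the index. The form h_1 is kept apart
  because \<open>bil\<close> at equal arguments only gives 2 h_1, which is zero in characteristic
  2.\<close>

lemma of_pol_h_Suc:
  assumes "k \<ge> 1"
  shows "of_pol (h m (Suc k) :: 'a::{field, finite} mpol) = bil m rvar (\<lambda>r. rvar r ^ (CARD('a) ^ k))"
  using assms
  by (simp add: h_def bil_def of_pol_add of_pol_sum of_pol_mult of_pol_power of_pol_2 mult_ac)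

text \<open>The variables and their Frobenius twist are transformed by the same isometry
  \<open>N\<close>, and \<open>N\<close> preserves \<open>quad\<close> and
  \<open>bil\<close>.\<close>

lemma of_pol_h_invariant:
  assumes g: "g \<in> (isometry_group m :: 'a::{field, finite} mat set)" and "k \<ge> 1"
  shows "act_frac g (of_pol (h m k)) = of_pol (h m k)"
proof -
  obtain N where N: "N \<in> isometry_group m"
    "\<And>r. r \<in> {1..2*m + 1} \<Longrightarrow> act_frac g (rvar r) = mat_app rconst N rvar r"
    using act_frac_rvar_ex[OF g] by blast
  note \<sigma> = ring_endo_act_frac[OF g]
  show ?thesis
  proof (cases "k = 1")
    case True
    have "act_frac g (quad m rvar) = quad m (mat_app rconst N rvar)"
      unfolding ring_endo_quad[OF \<sigma>] by (rule quad_cong) (rule N(2))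
    then show ?thesis by (simp only: True of_pol_h_1 quad_mat_app[OF N(1)])
  next
    case False
    then obtain j where j: "k = Suc j" "j \<ge> 1" using \<open>k \<ge> 1\<close> by (cases k) auto
    have "act_frac g (bil m rvar (\<lambda>r. rvar r ^ (CARD('a) ^ j)))
        = bil m (mat_app rconst N rvar) (mat_app rconst N (\<lambda>r. rvar r ^ (CARD('a) ^ j)))"
      unfolding ring_endo_bil[OF \<sigma>] ring_endo_power[OF \<sigma>]
      by (rule bil_cong) (simp_all only: N(2) mat_app_frobenius)
    then show ?thesis by (simp only: j(1) of_pol_h_Suc[OF j(2)] bil_mat_app[OF N(1)])
  qed
qed

text \<open>The Eichler transformation, transported to the action. The condition \<open>ci\<close>
  ensures that x_i is not itself one of the corrected partners, so that it moves by exactly the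
  given form.\<close>

lemma isometry_rvar_shift:
  fixes c :: "nat \<Rightarrow> 'a::{field, finite}"
  assumes i: "i \<in> {1..2*m + 1}" and c: "\<And>l. c l \<noteq> 0 \<Longrightarrow> 1 \<le> l \<and> l \<le> m \<and> l < i"
    and ci: "c (2*m + 2 - i) = 0"
  obtains g where "g \<in> isometry_group m"
    "act_frac g (rvar i) = rvar i + (\<Sum>l = 1..m. rconst (c l) * rvar l)"
    "\<And>r. r \<in> {1..2*m + 1} \<Longrightarrow> r \<noteq> i \<Longrightarrow> c (2*m + 2 - r) = 0 \<Longrightarrow> act_frac g (rvar r) = rvar r"
proof -
  show ?thesis
  proof (rule isometry_exists[where ?'b = "'a mpol fract", OF i c])
    fix N and p :: "('a \<Rightarrow> 'a mpol fract) \<Rightarrow> (nat \<Rightarrow> 'a mpol fract) \<Rightarrow> 'a mpol fract"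
    assume N: "N \<in> isometry_group m" and
      app: "\<And>(\<kappa> :: 'a \<Rightarrow> 'a mpol fract) x r. scalars \<kappa> \<Longrightarrow> r \<in> {1..2*m + 1} \<Longrightarrow>
        mat_app \<kappa> N x r = x r + (if r = i then \<Sum>l = 1..m. \<kappa> (c l) * x l else 0)
          - \<kappa> (c (2*m + 2 - r)) * p \<kappa> x"
    obtain g where g: "g \<in> isometry_group m"
      "\<And>r. r \<in> {1..2*m + 1} \<Longrightarrow> act_frac g (rvar r) = mat_app rconst N rvar r"
      using act_frac_rvar_realize[OF N] by blast
    have app': "act_frac g (rvar r) = rvar r
        + (if r = i then \<Sum>l = 1..m. rconst (c l) * rvar l else 0)
        - rconst (c (2*m + 2 - r)) * p rconst rvar" if "r \<in> {1..2*m + 1}" for r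
      unfolding g(2)[OF that] by (rule app[OF scalars_axioms that])
    show ?thesis
    proof (rule that[OF g(1)])
      show "act_frac g (rvar i) = rvar i + (\<Sum>l = 1..m. rconst (c l) * rvar l)"
        using app'[OF i] by (simp only: ci scalar_zero) simp
      show "act_frac g (rvar r) = rvar r"
        if "r \<in> {1..2*m + 1}" "r \<noteq> i" "c (2*m + 2 - r) = 0" for r
        using app'[OF that(1)] that(2) by (simp only: that(3) scalar_zero) simp
    qed
  qed
qed

lemma orbit_subset:
  assumes g: "g \<in> (isometry_group m :: 'a::{field, finite} mat set)" and i: "i \<in> {1..2*m + 1}"
  shows "\<exists>u\<in>lin_span rvar {1..<i}. act_frac g (rvar i) = rvar i + u"
proof -
  obtain N where N: "N \<in> isometry_group m"
    "\<And>r. r \<in> {1..2*m + 1} \<Longrightarrow> act_frac g (rvar r) = mat_app rconst N rvar r"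
    using act_frac_rvar_ex[OF g] by blast
  have "N \<in> unitri (2*m + 1)" using N(1) by (simp add: isometry_group_def)
  then have "act_frac g (rvar i) = rvar i + (\<Sum>s = 1..<i. rconst (N $$ (i - 1, s - 1)) * rvar s)"
    unfolding N(2)[OF i] using i by (rule mat_app_unitri)
  then show ?thesis by (rule bexI[OF _ lin_spanI])
qed

text \<open>For i \<le> m + 1 the form u involves only x_l with l \<le> m, and their partners have
  index at least m + 2. So the corrections leave x_1, ..., x_i alone.\<close>

lemma rvar_shift_from_lin_span:
  fixes u :: "'a::{field, finite} mpol fract"
  assumes i: "i \<in> {1..m + 1}" and u: "u \<in> lin_span rvar {1..<i}"
  obtains g where "g \<in> isometry_group m" "act_frac g (rvar i) = rvar i + u"
    "\<And>r. r \<in> {1..<i} \<Longrightarrow> act_frac g (rvar r) = rvar r"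
proof -
  obtain c where c: "u = (\<Sum>l = 1..<i. rconst (c l) * rvar l)"
    using u unfolding lin_span_def by blast
  define d where "d l = (if l \<in> {1..<i} then c l else 0)" for l
  have u': "u = (\<Sum>l = 1..m. rconst (d l) * rvar l)"
    unfolding c using i
    by (intro sum.mono_neutral_cong_left) (auto simp: d_def scalar_zero)
  have d0: "d (2*m + 2 - r) = 0" if "r \<le> i" for r
  proof -
    have "\<not> 2*m + 2 - r < i" using that i by auto
    then show ?thesis by (simp add: d_def)
  qed
  obtain g where "g \<in> isometry_group m" "act_frac g (rvar i) = rvar i + (\<Sum>l = 1..m. rconst (d l) * rvar l)"
    "\<And>r. r \<in> {1..2*m + 1} \<Longrightarrow> r \<noteq> i \<Longrightarrow> d (2*m + 2 - r) = 0 \<Longrightarrow> act_frac g (rvar r) = rvar r"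
  proof (rule isometry_rvar_shift[of i m d])
    show "i \<in> {1..2*m + 1}" using i by auto
    show "1 \<le> l \<and> l \<le> m \<and> l < i" if "d l \<noteq> 0" for l
      using that i by (auto simp: d_def split: if_splits)
  qed (use d0 in blast)+
  then show ?thesis using that d0 i u' by auto
qed

section \<open>Orbits of variables and their norms\<close>

lemma of_pol_orbit: "of_pol ` (\<lambda>g. act g (Var i)) ` isometry_group m
    = (\<lambda>g. act_frac g (rvar i)) ` (isometry_group m :: 'a::{field, finite} mat set)"
  by (simp add: image_image act_frac_of_pol)

lemma of_pol_orbit_norm:
  "of_pol (orbit_norm (isometry_group m :: 'a::{field, finite} mat set) i)
    = \<Prod>((\<lambda>g. act_frac g (rvar i)) ` (isometry_group m :: 'a mat set))"
proof -
  have "of_pol (orbit_norm (isometry_group m :: 'a mat set) i)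
      = \<Prod>(of_pol ` (\<lambda>g. act g (Var i)) ` (isometry_group m :: 'a mat set))"
    unfolding orbit_norm_def of_pol_prod
    by (subst prod.reindex) (simp_all add: inj_on_def of_pol_eq_iff)
  then show ?thesis unfolding of_pol_orbit .
qed

lemma finite_orbit:
  assumes "i \<in> {1..2*m + 1}"
  shows "finite ((\<lambda>g. act_frac g (rvar i)) ` (isometry_group m :: 'a::{field, finite} mat set))"
proof (rule finite_subset)
  show "(\<lambda>g. act_frac g (rvar i)) ` (isometry_group m :: 'a mat set) \<subseteq> (+) (rvar i) ` lin_span rvar {1..<i}"
    using orbit_subset[OF _ assms] by blast
qed (simp add: finite_lin_span)

text \<open>The map \<open>act_frac g\<close> sends the finite orbit injectively into itself, hence
  permutes the factors of the product.\<close>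

lemma of_pol_orbit_norm_invariant:
  assumes g: "g \<in> (isometry_group m :: 'a::{field, finite} mat set)" and i: "i \<in> {1..2*m + 1}"
  shows "act_frac g (of_pol (orbit_norm (isometry_group m) i)) = of_pol (orbit_norm (isometry_group m) i)"
proof -
  let ?G = "isometry_group m :: 'a mat set"
  let ?O = "(\<lambda>k. act_frac k (rvar i)) ` ?G"
  note \<sigma> = ring_endo_act_frac[OF g]
  obtain M where M: "M \<in> ?G" "\<And>r. r \<in> {1..2*m + 1} \<Longrightarrow> act_frac g (rvar r) = mat_app rconst M rvar r"
    using act_frac_rvar_ex[OF g] by blast
  have "act_frac g (act_frac k (rvar i)) \<in> ?O" if k: "k \<in> ?G" for k
  proof -
    obtain N where N: "N \<in> ?G" "\<And>r. r \<in> {1..2*m + 1} \<Longrightarrow> act_frac k (rvar r) = mat_app rconst N rvar r"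
      using act_frac_rvar_ex[OF k] by blast
    have col: "dim_col N = 2*m + 1" using isometry_matD[OF N(1)] by simp
    \<comment> \<open>Applying \<open>g\<close> fixes the entries of \<open>N\<close> and replaces
      the variables by their images under \<open>M\<close>. Hence the composite action belongs to
      \<open>N * M\<close>, with \<open>M\<close> as the inner factor.\<close>
    have "act_frac g (mat_app rconst N rvar i) = mat_app rconst N (mat_app rconst M rvar) i"
      unfolding mat_app_def[of _ N] ring_endo_sum[OF \<sigma>] ring_endo_mult[OF \<sigma>] act_frac_rconst[OF g]
      by (rule sum.cong[OF refl]) (simp only: col M(2))
    also have "\<dots> = mat_app rconst (N * M) rvar i"
      by (rule mat_app_mult[OF isometry_matD[OF N(1)] isometry_matD[OF M(1)] i, symmetric])
    finally have eq: "act_frac g (act_frac k (rvar i)) = mat_app rconst (N * M) rvar i"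
      by (simp only: N(2)[OF i])
    obtain k' where "k' \<in> ?G" "\<And>r. r \<in> {1..2*m + 1} \<Longrightarrow> act_frac k' (rvar r) = mat_app rconst (N * M) rvar r"
      using act_frac_rvar_realize[OF isometry_mult[OF N(1) M(1)]] by blast
    then show ?thesis unfolding eq using i by (metis image_eqI)
  qed
  then have sub: "act_frac g ` ?O \<subseteq> ?O" by blast
  have inj: "inj_on (act_frac g) ?O"
    using ring_endo_inj[OF \<sigma>] by (rule inj_on_subset) simp
  have "act_frac g ` ?O = ?O"
    by (rule endo_inj_surj[OF finite_orbit[OF i] sub inj])
  moreover have "act_frac g (\<Prod>?O) = \<Prod>(act_frac g ` ?O)"
    unfolding ring_endo_prod[OF \<sigma>] prod.reindex[OF inj] by simp
  ultimately show ?thesis by (simp only: of_pol_orbit_norm)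
qed

section \<open>Descent to the generated field\<close>

lemma monic_diff_const:
  fixes p :: "'b::field poly"
  assumes "lead_coeff p = 1" "degree p > 0"
  shows "degree (p - [:c:]) = degree p" "lead_coeff (p - [:c:]) = 1"
proof -
  show deg: "degree (p - [:c:]) = degree p"
  proof -
    have "p - [:c:] = p + [:- c:]"
      by (simp add: poly_eq_iff coeff_pCons split: nat.split)
    moreover have "degree (p + [:- c:]) = degree p"
      using assms(2) by (intro degree_add_eq_left) simp
    ultimately show ?thesis by (simp only:)
  qed
  have "coeff [:c:] (degree p) = 0" using assms(2) by (intro coeff_eq_0) simp
  then show "lead_coeff (p - [:c:]) = 1" using assms(1) by (simp only: deg coeff_diff) simp
qed

lemma field_adjoin_fixed:
  assumes g: "g \<in> (isometry_group m :: 'a::{field, finite} mat set)"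
    and S: "\<And>s. s \<in> S \<Longrightarrow> act_frac g (of_pol s) = of_pol s" and x: "x \<in> field_adjoin S"
  shows "act_frac g x = x"
proof -
  have "field_adjoin S \<subseteq> {x. act_frac g x = x}"
    by (rule field_adjoin_minimal[OF is_subfield_fixed[OF ring_endo_act_frac[OF g]]])
      (use S act_frac_rconst[OF g] in auto)
  then show ?thesis using x by blast
qed

lemma lin_span_subset:
  fixes E :: "'a::{field, finite} mpol fract set"
  assumes E: "is_subfield E" and "range rconst \<subseteq> E" "\<And>l. l \<in> I \<Longrightarrow> x l \<in> E"
  shows "lin_span x I \<subseteq> E"
proof
  fix u assume "u \<in> lin_span x I"
  then obtain c where "u = (\<Sum>l\<in>I. rconst (c l) * x l)" unfolding lin_span_def by blast
  moreover have "rconst (c l) \<in> E" for l using assms(2) by blast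
  ultimately show "u \<in> E" using assms(3) by (simp add: subfield_sum[OF E] subfield_mult[OF E])
qed

lemma zero_in_lin_span: "0 \<in> lin_span x I"
  using lin_spanI[of "\<lambda>_. 0" x I] by (simp add: scalar_zero)

text \<open>Unitriangularity gives one inclusion, the shifts by Eichler transformations the other.
  Consequently N(x_i) is the value at x_i of the product of all T + u.\<close>

lemma orbit_eq_lin_span:
  assumes i: "i \<in> {1..m + 1}"
  shows "(\<lambda>g. act_frac g (rvar i)) ` (isometry_group m :: 'a::{field, finite} mat set)
    = (+) (rvar i) ` lin_span rvar {1..<i}"
proof (intro Set.equalityI subsetI)
  fix y assume "y \<in> (\<lambda>g. act_frac g (rvar i)) ` (isometry_group m :: 'a mat set)"
  then show "y \<in> (+) (rvar i) ` lin_span rvar {1..<i}"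
    using orbit_subset[of _ m i] i by auto
next
  fix y assume "y \<in> (+) (rvar i) ` lin_span (rvar :: nat \<Rightarrow> 'a mpol fract) {1..<i}"
  then obtain u :: "'a mpol fract" where u: "u \<in> lin_span rvar {1..<i}" "y = rvar i + u" by blast
  show "y \<in> (\<lambda>g. act_frac g (rvar i)) ` (isometry_group m :: 'a mat set)"
    by (rule rvar_shift_from_lin_span[OF i u(1)]) (use u(2) in force)
qed

text \<open>The step past x_i. The polynomial \<open>?p - [:?N:]\<close> has its coefficients in the
  smaller field, because that field contains x_1, ..., x_{i-1} and hence their span, as well as the
  norm.\<close>

lemma descend_orbit_norm_variable:
  fixes S :: "'a::{field, finite} mpol set"
  assumes i: "i \<in> {1..m + 1}"
    and S: "\<And>g s. g \<in> isometry_group m \<Longrightarrow> s \<in> S \<Longrightarrow> act_frac g (of_pol s) = of_pol s"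
    and norm: "orbit_norm (isometry_group m) i \<in> S"
    and f: "f \<in> field_adjoin (S \<union> Var ` {1..i})"
    and inv: "\<And>g. g \<in> isometry_group m \<Longrightarrow> act_frac g f = f"
  shows "f \<in> field_adjoin (S \<union> Var ` {1..<i})"
proof -
  let ?T = "S \<union> Var ` {1..<i}"
  let ?U = "lin_span (rvar :: nat \<Rightarrow> 'a mpol fract) {1..<i}"
  let ?p = "\<Prod>u\<in>?U. [:u, 1:]"
  let ?N = "of_pol (orbit_norm (isometry_group m) i) :: 'a mpol fract"
  note E = is_subfield_field_adjoin[of ?T]
  have "{1..i} = insert i {1..<i}" using i by auto
  then have "f \<in> field_adjoin (insert (Var i) ?T)" using f by simp
  then obtain a b where ab: "a \<in> polys_over (field_adjoin ?T)" "b \<in> polys_over (field_adjoin ?T)"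
    "poly b (rvar i) \<noteq> 0" "f = poly a (rvar i) / poly b (rvar i)"
    by (rule field_adjoin_insertE)
  have U: "?U \<subseteq> field_adjoin ?T"
    by (rule lin_span_subset[OF E]) (use rconst_in_field_adjoin in \<open>auto intro: field_adjoin_incl\<close>)
  have finU: "finite ?U" by (simp add: finite_lin_span)
  have neU: "?U \<noteq> {}" using zero_in_lin_span by blast
  have deg: "degree ?p = card ?U" by (simp add: degree_prod_eq_sum_degree)
  have lead: "lead_coeff ?p = 1" by (simp add: lead_coeff_prod)
  have pos: "degree ?p > 0" unfolding deg using finU neU by (simp add: card_gt_0_iff)
  have N_in: "?N \<in> field_adjoin ?T" using norm by (intro field_adjoin_incl) blast
  have "?N = \<Prod>((+) (rvar i) ` ?U)" by (simp only: of_pol_orbit_norm orbit_eq_lin_span[OF i])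
  also have "\<dots> = (\<Prod>u\<in>?U. rvar i + u)" by (subst prod.reindex) (simp_all add: inj_on_def)
  also have "\<dots> = poly ?p (rvar i)" by (simp add: poly_prod add.commute)
  finally have root: "poly (?p - [:?N:]) (rvar i) = 0" by simp
  show ?thesis
  proof (rule descent_step[OF E _ _ _ root finU neU ab])
    show "?p - [:?N:] \<in> polys_over (field_adjoin ?T)"
      using U N_in
      by (intro polys_over_diff[OF E] polys_over_prod[OF E] polys_over_pCons[OF E]
          polys_over_zero[OF E] subfield_one[OF E]) blast+
    show "lead_coeff (?p - [:?N:]) = 1" "degree (?p - [:?N:]) = card ?U"
      using monic_diff_const[OF lead pos] deg by simp_all
    fix u assume u: "u \<in> ?U"
    show "\<exists>\<sigma>. ring_endo \<sigma> \<and> (\<forall>x\<in>field_adjoin ?T. \<sigma> x = x) \<and> \<sigma> f = f \<and> \<sigma> (rvar i) = rvar i + u"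
    proof (rule rvar_shift_from_lin_span[OF i u])
      fix g :: "'a mat"
      assume g: "g \<in> isometry_group m" "act_frac g (rvar i) = rvar i + u"
        "\<And>r. r \<in> {1..<i} \<Longrightarrow> act_frac g (rvar r) = rvar r"
      have "\<forall>x\<in>field_adjoin ?T. act_frac g x = x"
        using field_adjoin_fixed[OF g(1), of ?T] S[OF g(1)] g(3) by blast
      then show ?thesis using ring_endo_act_frac[OF g(1)] inv[OF g(1)] g(2) by blast
    qed
  qed
qed

lemma sum_split_at:
  assumes "1 \<le> j" "j \<le> m + 1"
  shows "(\<Sum>l = 1..m. F l) = (\<Sum>l = 1..<j. F l) + (\<Sum>l = j..m. F (l :: nat) :: 'b::comm_monoid_add)"
proof -
  have "{1..m} = {1..<j} \<union> {j..m}" using assms by auto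
  then show ?thesis by (simp only:) (rule sum.union_disjoint, auto)
qed

text \<open>The step past y_j, the variable of index 2m + 2 - j, while y_1, ..., y_{j-1} are still
  adjoined. Knowing e(y_j) in the smaller field makes y_j a root of a polynomial of degree q^(m-j)
  over it.\<close>

lemma descend_partner_variable:
  fixes S :: "'a::{field, finite} mpol set"
  assumes j: "j \<in> {1..m}"
    and S: "\<And>g s. g \<in> isometry_group m \<Longrightarrow> s \<in> S \<Longrightarrow> act_frac g (of_pol s) = of_pol s"
    and h: "h m ` {1..m} \<subseteq> S"
    and f: "f \<in> field_adjoin (S \<union> Var ` {1..m + 1} \<union> Var ` {2*m + 2 - j..2*m + 1})"
    and inv: "\<And>g. g \<in> isometry_group m \<Longrightarrow> act_frac g f = f"
  shows "f \<in> field_adjoin (S \<union> Var ` {1..m + 1} \<union> Var ` {2*m + 3 - j..2*m + 1})"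
proof -
  let ?T = "S \<union> Var ` {1..m + 1} \<union> Var ` {2*m + 3 - j..2*m + 1}"
  let ?E = "field_adjoin ?T"
  let ?q = "CARD('a)"
  let ?I = "{j + 1..m}"
  let ?U = "lin_span (rvar :: nat \<Rightarrow> 'a mpol fract) ?I"
  let ?i = "2*m + 2 - j"
  define x :: "nat \<Rightarrow> 'a mpol fract" where "x = rvar"
  define y :: "nat \<Rightarrow> 'a mpol fract" where "y l = rvar (2*m + 2 - l)" for l
  note E = is_subfield_field_adjoin[of ?T]
  have "{?i..2*m + 1} = insert ?i {2*m + 3 - j..2*m + 1}" using j by auto
  then have "f \<in> field_adjoin (insert (Var ?i) ?T)" using f by simp
  then obtain a b where ab: "a \<in> polys_over ?E" "b \<in> polys_over ?E"
    "poly b (rvar ?i) \<noteq> 0" "f = poly a (rvar ?i) / poly b (rvar ?i)"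
    by (rule field_adjoin_insertE)
  have xE: "x l \<in> ?E" if "l \<in> {1..m + 1}" for l
    unfolding x_def using that by (intro field_adjoin_incl) blast
  have yE: "y l \<in> ?E" if "l \<in> {1..<j}" for l
  proof -
    have "2*m + 2 - l \<in> {2*m + 3 - j..2*m + 1}" using that j by auto
    then show ?thesis unfolding y_def by (intro field_adjoin_incl) blast
  qed
  have hE: "of_pol (h m k) \<in> ?E" if "k \<in> {1..m}" for k
    using that h by (intro field_adjoin_incl) blast
  have two: "2 \<in> ?E" using subfield_add[OF E subfield_one[OF E] subfield_one[OF E]] by simp
  \<comment> \<open>Remove from h_1 the square of x_{m+1} and the products with l < j, whose factors
    are all adjoined.\<close>
  have diag: "(\<Sum>l = j..m. x l * y l) \<in> ?E"
  proof -
    have "(\<Sum>l = 1..m. x l * y l) + x (m + 1) ^ 2 = of_pol (h m 1)"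
      by (simp only: of_pol_h_1 quad_def x_def y_def)
    moreover have "(\<Sum>l = 1..m. x l * y l) = (\<Sum>l = 1..<j. x l * y l) + (\<Sum>l = j..m. x l * y l)"
      using j by (intro sum_split_at) auto
    ultimately have "(\<Sum>l = j..m. x l * y l)
        = of_pol (h m 1) - x (m + 1) ^ 2 - (\<Sum>l = 1..<j. x l * y l)"
      by (simp add: algebra_simps)
    also have "\<dots> \<in> ?E"
      using j by (intro subfield_diff[OF E] subfield_power[OF E] subfield_sum[OF E]
          subfield_mult[OF E] hE xE yE) auto
    finally show ?thesis .
  qed
  \<comment> \<open>From k \<le> m - j and j \<ge> 1 follows k + 1 \<le> m, so h_{k+1} is one of the
    generators.\<close>
  have alt: "(\<Sum>l = j..m. x l * y l ^ (?q ^ k) + x l ^ (?q ^ k) * y l) \<in> ?E"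
    if k: "1 \<le> k" "k \<le> card ?I" for k
  proof -
    let ?F = "\<lambda>l. x l * y l ^ (?q ^ k) + x l ^ (?q ^ k) * y l"
    have "(\<Sum>l = 1..m. ?F l) + 2 * x (m + 1) * x (m + 1) ^ (?q ^ k) = of_pol (h m (Suc k))"
      by (simp add: of_pol_h_Suc[OF k(1)] bil_def x_def y_def mult.commute)
    moreover have "(\<Sum>l = 1..m. ?F l) = (\<Sum>l = 1..<j. ?F l) + (\<Sum>l = j..m. ?F l)"
      using j by (intro sum_split_at) auto
    ultimately have "(\<Sum>l = j..m. ?F l)
        = of_pol (h m (Suc k)) - 2 * x (m + 1) * x (m + 1) ^ (?q ^ k) - (\<Sum>l = 1..<j. ?F l)"
      by (simp add: algebra_simps)
    also have "\<dots> \<in> ?E"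
      using j k by (intro subfield_diff[OF E] subfield_power[OF E] subfield_sum[OF E]
          subfield_add[OF E] subfield_mult[OF E] hE xE yE two) auto
    finally show ?thesis .
  qed
  \<comment> \<open>The list x_{j+1}, ..., x_m has length m - j, so the degree of e will equal the
    size q^(m-j) of \<open>?U\<close>.\<close>
  have "set (map x [j + 1..<m + 1]) \<subseteq> ?E" using xE by auto
  from additive_poly_vanishing[OF E this] obtain w where
    w: "\<And>k. w k \<in> ?E" "w (m - j) = 1" and
    van': "\<forall>v\<in>x ` {j + 1..<m + 1}. poly (additive_poly w (m - j)) v = 0"
    by (auto simp del: upt_Suc)
  have card: "card ?I = m - j" by simp
  have van: "poly (additive_poly w (card ?I)) (x l) = 0" if "l \<in> ?I" for l
    using van' that unfolding card by auto
  have w1: "w (card ?I) = 1" using w(2) by (simp only: card)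
  let ?e = "additive_poly w (card ?I)"
  have nz: "poly ?e (x j) \<noteq> 0"
  proof (rule additive_poly_nonzero[where x = x and I = ?I and w = w, OF _ _ w1 van])
    show "finite ?I" by simp
    then show "lin_indep x ?I" unfolding x_def by (rule lin_indep_rvar)
    show "x j \<notin> lin_span x ?I" unfolding x_def by (rule rvar_notin_lin_span) simp_all
  qed
  have "(\<Sum>l = j..m. poly ?e (x l) * poly ?e (y l)) \<in> ?E"
    by (rule sum_additive_poly_products_in_subfield[OF E w(1) diag alt])
  \<comment> \<open>All summands with l > j vanish, since e was chosen to be zero at those
    x_l.\<close>
  also have "(\<Sum>l = j..m. poly ?e (x l) * poly ?e (y l)) = poly ?e (x j) * poly ?e (y j)"
  proof -
    have "{j..m} = insert j ?I" using j by auto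
    then have "(\<Sum>l = j..m. poly ?e (x l) * poly ?e (y l))
        = poly ?e (x j) * poly ?e (y j) + (\<Sum>l\<in>?I. poly ?e (x l) * poly ?e (y l))" by simp
    also have "(\<Sum>l\<in>?I. poly ?e (x l) * poly ?e (y l)) = 0"
      by (intro sum.neutral ballI) (simp only: van mult_zero_left)
    finally show ?thesis by simp
  qed
  finally have prod: "poly ?e (x j) * poly ?e (y j) \<in> ?E" .
  have e_over: "?e \<in> polys_over ?E" by (rule additive_poly_in[OF E w(1)])
  have "poly ?e (x j) \<in> ?E"
    unfolding poly_additive_poly using j
    by (intro subfield_sum[OF E] subfield_mult[OF E] subfield_power[OF E] w(1) xE) auto
  then have eyE: "poly ?e (y j) \<in> ?E"
    using subfield_divide[OF E prod, of "poly ?e (x j)"] nz by simp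
  have lead: "lead_coeff ?e = 1" and deg: "degree ?e = ?q ^ card ?I"
    using lead_coeff_additive_poly[of w, OF w1] degree_additive_poly[of w, OF w1] by simp_all
  have pos: "degree ?e > 0" unfolding deg by simp
  have cardU: "card ?U = ?q ^ card ?I"
    by (rule card_lin_span) (auto intro: lin_indep_rvar)
  have finU: "finite ?U" by (simp add: finite_lin_span)
  have neU: "?U \<noteq> {}" using zero_in_lin_span by blast
  have root: "poly (?e - [:poly ?e (y j):]) (rvar ?i) = 0"
    by (simp add: y_def)
  show ?thesis
  proof (rule descent_step[OF E _ _ _ root finU neU ab])
    show "?e - [:poly ?e (y j):] \<in> polys_over ?E"
      by (intro polys_over_diff[OF E] polys_over_pCons[OF E] polys_over_zero[OF E] e_over eyE)
    show "lead_coeff (?e - [:poly ?e (y j):]) = 1" "degree (?e - [:poly ?e (y j):]) = card ?U"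
      by (fact monic_diff_const(2)[OF lead pos], simp only: monic_diff_const(1)[OF lead pos] deg cardU)
    fix u assume "u \<in> ?U"
    then obtain c where c: "u = (\<Sum>l\<in>?I. rconst (c l) * rvar l)"
      unfolding lin_span_def by blast
    \<comment> \<open>Extension of \<open>c\<close> by zero. In particular \<open>d j = 0\<close>,
      and \<open>j\<close> is the partner index of \<open>?i\<close>, so y_j receives no correction
      and moves by exactly \<open>u\<close>.\<close>
    define d where "d l = (if l \<in> ?I then c l else 0)" for l
    have u: "u = (\<Sum>l = 1..m. rconst (d l) * rvar l)"
      unfolding c by (intro sum.mono_neutral_cong_left) (auto simp: d_def scalar_zero)
    have i: "?i \<in> {1..2*m + 1}" using j by auto
    have d_supp: "1 \<le> l \<and> l \<le> m \<and> l < ?i" if "d l \<noteq> 0" for l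
    proof -
      have "l \<in> ?I" using that by (auto simp: d_def split: if_splits)
      then show ?thesis using j by auto
    qed
    have "2*m + 2 - ?i = j" using j by simp
    then have di: "d (2*m + 2 - ?i) = 0" by (simp add: d_def)
    show "\<exists>\<sigma>. ring_endo \<sigma> \<and> (\<forall>x\<in>?E. \<sigma> x = x) \<and> \<sigma> f = f \<and> \<sigma> (rvar ?i) = rvar ?i + u"
    proof (rule isometry_rvar_shift[where c = d, OF i d_supp di])
      fix g :: "'a mat"
      assume g: "g \<in> isometry_group m"
        "act_frac g (rvar ?i) = rvar ?i + (\<Sum>l = 1..m. rconst (d l) * rvar l)"
        "\<And>r. r \<in> {1..2*m + 1} \<Longrightarrow> r \<noteq> ?i \<Longrightarrow> d (2*m + 2 - r) = 0 \<Longrightarrow>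
          act_frac g (rvar r) = rvar r"
      \<comment> \<open>Corrections affect only y_l with j < l \<le> m, and none of these is among
        the adjoined variables.\<close>
      have fixed: "act_frac g (rvar r) = rvar r" if "r \<in> {1..m + 1} \<union> {2*m + 3 - j..2*m + 1}" for r
      proof (rule g(3))
        show "r \<in> {1..2*m + 1}" "r \<noteq> ?i" using that j by auto
        have "2*m + 2 - r \<notin> ?I" using that j by auto
        then show "d (2*m + 2 - r) = 0" unfolding d_def by (rule if_not_P)
      qed
      have "act_frac g (of_pol s) = of_pol s" if "s \<in> ?T" for s
        using that S[OF g(1)] fixed by blast
      then have "\<forall>x\<in>?E. act_frac g x = x"
        using field_adjoin_fixed[OF g(1), of ?T] by blast
      then show ?thesis using ring_endo_act_frac[OF g(1)] inv[OF g(1)] g(2) u by blast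
    qed
  qed
qed

lemma is_subfield_invariant_field:
  "is_subfield (invariant_field n (isometry_group m :: 'a::{field, finite} mat set))"
proof -
  have "is_subfield {x. act_frac g x = x}" if "g \<in> (isometry_group m :: 'a mat set)" for g
    by (rule is_subfield_fixed[OF ring_endo_act_frac[OF that]])
  then show ?thesis
    using is_subfield_ratfuns[of n, where ?'a = 'a]
    unfolding is_subfield_def invariant_field_def by simp
qed

text \<open>One inclusion is minimality of the generated field. For the other, all variables are
  adjoined and then discarded one at a time while the given invariant stays inside.\<close>

lemma invariant_field_eq_field_adjoin:
  fixes m :: nat
  defines "G \<equiv> (isometry_group m :: 'a::{field, finite} mat set)"
  shows "invariant_field (2*m + 1) G = field_adjoin (orbit_norm G ` {1..m + 1} \<union> h m ` {1..m})"
proof (rule subset_antisym)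
  let ?n = "2*m + 1"
  let ?S = "orbit_norm G ` {1..m + 1} \<union> h m ` {1..m}"
  have S_inv: "act_frac g (of_pol s) = of_pol s" if "g \<in> G" "s \<in> ?S" for g s
    using that of_pol_orbit_norm_invariant[of g m] of_pol_h_invariant[of g m] by (auto simp: G_def)
  note R = is_subfield_ratfuns[of ?n, where ?'a = 'a]
  have rconst_R: "range rconst \<subseteq> (ratfuns ?n :: 'a mpol fract set)"
    by (auto intro: of_pol_in_ratfuns Const_in_polys)
  have rvar_R: "(rvar r :: 'a mpol fract) \<in> ratfuns ?n" if "r \<in> {1..?n}" for r
    using that by (intro of_pol_in_ratfuns Var_in_polys)
  have S_R: "of_pol s \<in> ratfuns ?n" if "s \<in> ?S" for s
    using that
  proof
    assume "s \<in> orbit_norm G ` {1..m + 1}"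
    then obtain i where i: "i \<in> {1..m + 1}" "s = orbit_norm G i" by blast
    have "lin_span rvar {1..<i} \<subseteq> (ratfuns ?n :: 'a mpol fract set)"
      using i(1) by (intro lin_span_subset[OF R rconst_R] rvar_R) auto
    moreover have "(rvar i :: 'a mpol fract) \<in> ratfuns ?n" using i(1) by (intro rvar_R) auto
    ultimately have "y \<in> ratfuns ?n" if "y \<in> (+) (rvar i) ` lin_span rvar {1..<i}" for y :: "'a mpol fract"
      using that subfield_add[OF R] by blast
    then show ?thesis
      unfolding i(2) G_def of_pol_orbit_norm orbit_eq_lin_span[OF i(1)]
      by (intro subfield_prod[OF R])
  next
    assume "s \<in> h m ` {1..m}"
    then obtain k where k: "k \<in> {1..m}" "s = h m k" by blast
    have V: "(rvar l :: 'a mpol fract) \<in> ratfuns ?n" "(rvar (2*m + 2 - l) :: 'a mpol fract) \<in> ratfuns ?n"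
      if "l \<in> {1..m}" for l
      using rvar_R[of l] rvar_R[OF partner_in_range[OF that]] that by (simp, blast)
    have M: "(rvar (m + 1) :: 'a mpol fract) \<in> ratfuns ?n" by (rule rvar_R) simp
    have two: "(2 :: 'a mpol fract) \<in> ratfuns ?n"
      using subfield_add[OF R subfield_one[OF R] subfield_one[OF R]] by simp
    show ?thesis
    proof (cases "k = 1")
      case True
      then show ?thesis
        unfolding k(2) by (simp only: of_pol_h_1 quad_def)
          (intro subfield_add[OF R] subfield_sum[OF R] subfield_mult[OF R] subfield_power[OF R] V M)
    next
      case False
      then obtain l where "k = Suc l" "l \<ge> 1" using k(1) by (cases k) auto
      then show ?thesis
        unfolding k(2) by (simp only: of_pol_h_Suc bil_def)
          (intro subfield_add[OF R] subfield_sum[OF R] subfield_mult[OF R] subfield_power[OF R] V M two)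
    qed
  qed
  show "field_adjoin ?S \<subseteq> invariant_field ?n G"
  proof (rule field_adjoin_minimal)
    show "is_subfield (invariant_field ?n G)"
      unfolding G_def by (rule is_subfield_invariant_field)
    show "range rconst \<subseteq> invariant_field ?n G"
      using rconst_R act_frac_rconst[of _ m] by (auto simp: invariant_field_def G_def)
    show "of_pol ` ?S \<subseteq> invariant_field ?n G"
      using S_R S_inv unfolding invariant_field_def by blast
  qed
  show "invariant_field ?n G \<subseteq> field_adjoin ?S"
  proof
    fix f assume "f \<in> invariant_field ?n G"
    then have f: "f \<in> ratfuns ?n" and inv: "\<And>g. g \<in> G \<Longrightarrow> act_frac g f = f"
      by (auto simp: invariant_field_def)
    have "{1..?n} \<subseteq> {1..m + 1} \<union> {2*m + 2 - m..?n}" by auto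
    then have "Var ` {1..?n} \<subseteq> ?S \<union> Var ` {1..m + 1} \<union> Var ` {2*m + 2 - m..?n}" by blast
    then have start: "f \<in> field_adjoin (?S \<union> Var ` {1..m + 1} \<union> Var ` {2*m + 2 - m..?n})"
      using f ratfuns_subset_field_adjoin by blast
    \<comment> \<open>Here \<open>d\<close> counts the discarded y variables, y_m going first and
      y_1 last; at d = m the second interval is empty.\<close>
    have "f \<in> field_adjoin (?S \<union> Var ` {1..m + 1} \<union> Var ` {2*m + 2 - (m - d)..?n})" if "d \<le> m" for d
      using that
    proof (induction d)
      case 0
      then show ?case using start by simp
    next
      case (Suc d)
      have "f \<in> field_adjoin (?S \<union> Var ` {1..m + 1} \<union> Var ` {2*m + 3 - (m - d)..?n})"
      proof (rule descend_partner_variable)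
        show "m - d \<in> {1..m}" using Suc.prems by auto
        show "act_frac g (of_pol s) = of_pol s" if "g \<in> isometry_group m" "s \<in> ?S" for g s
          using S_inv that by (simp add: G_def)
        show "f \<in> field_adjoin (?S \<union> Var ` {1..m + 1} \<union> Var ` {2*m + 2 - (m - d)..2*m + 1})"
          using Suc by simp
      qed (use inv G_def in auto)
      moreover have "2*m + 3 - (m - d) = 2*m + 2 - (m - Suc d)" using Suc.prems by simp
      ultimately show ?case by (simp only:)
    qed
    from this[of m] have mid: "f \<in> field_adjoin (?S \<union> Var ` {1..m + 1})" by simp
    \<comment> \<open>Then x_{m+1}, ..., x_1 are discarded, largest index first.\<close>
    have "f \<in> field_adjoin (?S \<union> Var ` {1..m + 1 - d})" if "d \<le> m + 1" for d
      using that
    proof (induction d)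
      case 0
      then show ?case using mid by simp
    next
      case (Suc d)
      have "f \<in> field_adjoin (?S \<union> Var ` {1..<m + 1 - d})"
      proof (rule descend_orbit_norm_variable)
        show "m + 1 - d \<in> {1..m + 1}" using Suc.prems by auto
        then show "orbit_norm (isometry_group m) (m + 1 - d) \<in> ?S" unfolding G_def by blast
        show "act_frac g (of_pol s) = of_pol s" if "g \<in> isometry_group m" "s \<in> ?S" for g s
          using S_inv that by (simp add: G_def)
        show "f \<in> field_adjoin (?S \<union> Var ` {1..m + 1 - d})" using Suc by simp
      qed (use inv G_def in auto)
      moreover have "{1..<m + 1 - d} = {1..m + 1 - Suc d}" using Suc.prems by auto
      ultimately show ?case by (simp only:)
    qed
    from this[of "m + 1"] show "f \<in> field_adjoin ?S" by simp
  qed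
qed

text \<open>The span of no variables is zero, so the orbit of x_1 is a single point; this turns the
  first generating set of the theorem into the second.\<close>

lemma orbit_norm_1: "orbit_norm (isometry_group m :: 'a::{field, finite} mat set) 1 = Var 1"
proof -
  have "lin_span rvar {1..<1} = {0 :: 'a mpol fract}" by (simp add: lin_span_def)
  then have "of_pol (orbit_norm (isometry_group m :: 'a mat set) 1) = rvar 1"
    unfolding of_pol_orbit_norm using orbit_eq_lin_span[of 1 m, where ?'a = 'a] by simp
  then show ?thesis by (simp add: of_pol_eq_iff)
qed

theorem theorem4p24:
  fixes m :: nat
    and G :: "'a::{field, finite} mat set"
  assumes "m \<ge> 1"
    and "G = sylow_G m"
  shows "invariant_field (2*m + 1) G
           = field_adjoin (orbit_norm G ` {1..m+1} \<union> h m ` {1..m})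
       \<and> invariant_field (2*m + 1) G
           = field_adjoin ({Var 1} \<union> orbit_norm G ` {2..m+1} \<union> h m ` {1..m})"
proof -
  have G: "G = isometry_group m" using assms(2) by (simp add: sylow_G_eq_isometry_group)
  have "{1..m + 1} = insert 1 {2..m + 1}" by auto
  then have "orbit_norm G ` {1..m + 1} = {Var 1} \<union> orbit_norm G ` {2..m + 1}"
    using orbit_norm_1[of m, where ?'a = 'a] unfolding G by simp
  then show ?thesis
    using invariant_field_eq_field_adjoin[of m, where ?'a = 'a] unfolding G by simp
qed

end
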